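(* Let $p$ be a prime number and $G=\mathbb{Z}/p\mathbb{Z}$. Let $V$ be a finite-dimensional representation of $G$ over a field $\mathbf{k}$ with $\operatorname{char}\mathbf{k}\neq p$, and suppose that at least $3$ distinct nontrivial characters of $G$ occur in $V$. Then $$\beta_{\mathrm{field}}(G,V)\leq\frac{p+3}{2}.$$
   Context: $\mathbf{k}[V]$ is the ring of polynomial functions on $V$, $\mathbf{k}(V)$ its fraction field, with $G$ acting by $(gf)(v)=f(g^{-1}v)$; $\mathbf{k}[V]^G$, $\mathbf{k}(V)^G$ are the invariants, and $\mathbf{k}[V]^G_{\leq d}$ is the space of invariant polynomials of degree at most $d$. $\beta_{\mathrm{field}}(G,V)$ is the least natural number $d$ such that $\mathbf{k}[V]^G_{\leq d}$ generates $\mathbf{k}(V)^G$ as a field extension of $\mathbf{k}$. The characters occurring in $V$ means the characters $G\to \mathbf{K}^\times$ occurring in $\mathbf{K}\otimes_{\mathbf{k}} V$, where $\mathbf{K}\supseteq \mathbf{k}$ is an extension field containing the $p$th roots of unity. *)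

theory Defs
  imports
    "HOL-Analysis.Analysis"
    "HOL-Library.Poly_Mapping"
    "HOL-Computational_Algebra.Fraction_Field"
    "HOL-Algebra.Elementary_Groups"
    "HOL-Algebra.Generated_Fields"
    "HOL-Algebra.Algebraic_Closure_Type"
begin

section \<open>Matrix representations and characters\<close>

text \<open>A representation of a group \<open>G\<close> on \<open>V = 'k ^ 'n\<close> is an element of \<open>hom G GL\<close>.\<close>

definition GL :: "('k::field ^ 'n ^ 'n) monoid" where
  "GL = \<lparr>carrier = {A. invertible A}, monoid.mult = (**), one = mat 1\<rparr>"

definition field_embedding :: "('k::field \<Rightarrow> 'c::field) \<Rightarrow> bool" where
  "field_embedding \<iota> \<longleftrightarrow> \<iota> \<in> ring_hom ring_of_type_algebra ring_of_type_algebra"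

text \<open>Characters with values in the multiplicative group of \<open>'c\<close>. They are made
  \<^const>\<open>extensional\<close>, so that two characters are equal as functions iff they agree on
  \<open>carrier G\<close>.\<close>

definition characters :: "('g, 'b) monoid_scheme \<Rightarrow> ('g \<Rightarrow> 'c::field) set" where
  "characters G = hom G (units_of (ring_of_type_algebra :: 'c ring)) \<inter> extensional (carrier G)"

definition nontrivial_char :: "('g, 'b) monoid_scheme \<Rightarrow> ('g \<Rightarrow> 'c::field) \<Rightarrow> bool" where
  "nontrivial_char G \<psi> \<longleftrightarrow> (\<exists>g\<in>carrier G. \<psi> g \<noteq> 1)"

text \<open>Extension of scalars along \<open>\<iota>\<close> replaces \<open>V\<close> by \<open>'c ^ 'n\<close> and \<open>\<rho> g\<close> by its entrywise
  image. A character occurs if some line of \<open>'c ^ 'n\<close> is stable under \<open>G\<close> and \<open>G\<close> acts on it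
  through that character.\<close>

definition occurs_in ::
  "('g, 'b) monoid_scheme \<Rightarrow> ('k::field \<Rightarrow> 'c::field) \<Rightarrow> ('g \<Rightarrow> 'k ^ 'n ^ 'n) \<Rightarrow> ('g \<Rightarrow> 'c) \<Rightarrow> bool"
where
  "occurs_in G \<iota> \<rho> \<psi> \<longleftrightarrow>
     (\<exists>v :: 'c ^ 'n. v \<noteq> 0 \<and> (\<forall>g\<in>carrier G. map_matrix \<iota> (\<rho> g) *v v = \<psi> g *s v))"

section \<open>Polynomial and rational functions on \<open>V\<close>\<close>

text \<open>\<open>k[V]\<close> is the ring of formal polynomials in the coordinates \<open>x\<^sub>i\<close> of \<open>V = 'k ^ 'n\<close>, i.e. the
  symmetric algebra of the dual space. (For finite \<open>'k\<close>, literal functions on \<open>V\<close> would not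
  form an integral domain.) The order on \<open>'n\<close> serves only to obtain the \<^class>\<open>idom\<close> instance
  needed for the fraction field \<open>k(V)\<close>; it plays no other role.\<close>

type_synonym ('n, 'k) polys = "('n \<Rightarrow>\<^sub>0 nat) \<Rightarrow>\<^sub>0 'k"

definition const :: "'k::field \<Rightarrow> ('n, 'k) polys" where
  "const c = Poly_Mapping.single 0 c"

definition coord :: "'n \<Rightarrow> ('n, 'k::field) polys" where
  "coord i = Poly_Mapping.single (Poly_Mapping.single i 1) 1"

definition degree_le :: "nat \<Rightarrow> ('n::finite, 'k::field) polys \<Rightarrow> bool" where
  "degree_le d f \<longleftrightarrow> (\<forall>m\<in>Poly_Mapping.keys f. (\<Sum>i\<in>UNIV. Poly_Mapping.lookup m i) \<le> d)"

definition poly_subst ::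
  "('n::finite \<Rightarrow> ('n, 'k::field) polys) \<Rightarrow> ('n, 'k) polys \<Rightarrow> ('n, 'k) polys" where
  "poly_subst s f =
     (\<Sum>m\<in>Poly_Mapping.keys f.
        const (Poly_Mapping.lookup f m) * (\<Prod>i\<in>UNIV. s i ^ Poly_Mapping.lookup m i))"

text \<open>\<open>(g f)(v) = f(g\<inverse> v)\<close>: the coordinate \<open>x\<^sub>i\<close> is replaced by the linear form
  \<open>v \<mapsto> x\<^sub>i(g\<inverse> v)\<close>, whose coefficients form row \<open>i\<close> of \<open>\<rho>(g\<inverse>)\<close>.\<close>

definition poly_act ::
  "('g, 'b) monoid_scheme \<Rightarrow> ('g \<Rightarrow> 'k::field ^ 'n ^ 'n)
     \<Rightarrow> 'g \<Rightarrow> ('n, 'k) polys \<Rightarrow> ('n, 'k) polys" where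
  "poly_act G \<rho> g = poly_subst (\<lambda>i. \<Sum>j\<in>UNIV. const (\<rho> (inv\<^bsub>G\<^esub> g) $ i $ j) * coord j)"

text \<open>The induced action \<open>g (a / b) = (g a) / (g b)\<close>. If \<open>\<rho>\<close> is a representation, each \<open>g\<close> acts
  on polynomials by a ring automorphism, so the right-hand side does not depend on the choice of
  numerator and denominator.\<close>

definition frac_act ::
  "('g, 'b) monoid_scheme \<Rightarrow> ('g \<Rightarrow> 'k::field ^ 'n::{finite, linorder} ^ 'n::{finite, linorder})
     \<Rightarrow> 'g \<Rightarrow> ('n, 'k) polys fract \<Rightarrow> ('n, 'k) polys fract" where
  "frac_act G \<rho> g q =
     (THE r. \<exists>a b. b \<noteq> 0 \<and> q = Fraction_Field.Fract a b
        \<and> r = Fraction_Field.Fract (poly_act G \<rho> g a) (poly_act G \<rho> g b))"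

definition invariant_polys_le ::
  "('g, 'b) monoid_scheme \<Rightarrow> ('g \<Rightarrow> 'k::field ^ 'n ^ 'n) \<Rightarrow> nat \<Rightarrow> ('n, 'k) polys set" where
  "invariant_polys_le G \<rho> d = {f. degree_le d f \<and> (\<forall>g\<in>carrier G. poly_act G \<rho> g f = f)}"

definition invariant_field ::
  "('g, 'b) monoid_scheme \<Rightarrow> ('g \<Rightarrow> 'k::field ^ 'n::{finite, linorder} ^ 'n::{finite, linorder})
     \<Rightarrow> ('n, 'k) polys fract set" where
  "invariant_field G \<rho> = {q. \<forall>g\<in>carrier G. frac_act G \<rho> g q = q}"

definition poly_to_frac :: "('n::{finite, linorder}, 'k::field) polys \<Rightarrow> ('n, 'k) polys fract" where
  "poly_to_frac f = Fraction_Field.Fract f 1"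

definition field_generated_over_k ::
  "('n::{finite, linorder}, 'k::field) polys set \<Rightarrow> ('n, 'k) polys fract set" where
  "field_generated_over_k S =
     generate_field ring_of_type_algebra (poly_to_frac ` (range const \<union> S))"

definition beta_field ::
  "('g, 'b) monoid_scheme \<Rightarrow> ('g \<Rightarrow> 'k::field ^ 'n::{finite, linorder} ^ 'n::{finite, linorder}) \<Rightarrow> nat" where
  "beta_field G \<rho> =
     (LEAST d. field_generated_over_k (invariant_polys_le G \<rho> d) = invariant_field G \<rho>)"

end

(*
Let K contain a primitive p-th root of unity. Averaging the translates of the coordinates against
the p-th roots of unity gives eigenforms that span the linear forms of K[V], so an invariant
polynomial is a combination of products of eigenforms whose weights sum to 0 mod p. Three nontrivial
characters give two nonzero weights a, b with a not congruent to b or -b; after scaling, (a, b) is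
(1, t) with 2 <= t <= p - 2. The lattice of all (x, y) with x + t y = 0 (mod p) has a basis of
vectors in N^2 of coordinate sum at most (p + 3) / 2, and every residue is x + t y with x, y >= 0
and x + y <= (p + 1) / 2; hence every invariant product of eigenforms is a quotient of products of
invariant ones of degree at most (p + 3) / 2. Applying a k-linear functional K -> k to the
coefficients turns a relation f D = N over K into one over k.
*)
theory Submission
  imports Defs "HOL-Number_Theory.Cong"
begin

section \<open>Two weights modulo \<open>p\<close>\<close>

text \<open>Since quotients are allowed, only the group generated by the low-degree monomials
  matters: a lattice basis suffices where generating the ring would require a whole monoid of
  exponents. The basis must still lie in N^2, its vectors being exponents of polynomials, and this
  is why t must not be 1 or p - 1: for t = 1 every nonzero lattice vector in N^2 has coordinate sum
  at least p, and for t = p - 1 those of sum below p are multiples of (1, 1). Two nontrivial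
  characters could be inverse to each other; a third one removes the obstruction. The bound (p + 3)
  / 2 arises twice: as the length of a basis vector (for t = 2 the basis chosen here attains it),
  and as (p + 1) / 2 plus one, when a monomial in the two chosen eigenforms cancels the weight of
  one further eigenform. The obstacle in the descent is that a linear functional is not
  multiplicative, so its effect on the algebra generated by low-degree invariants over K is not
  clear at once; that algebra is first shown to consist of sums of K-multiples of its counterpart
  over k.\<close>

lemma small_representative:
  fixes p t z :: nat
  assumes p: "odd p" and t: "2 \<le> t" "t + 2 \<le> p" and z: "z < p"
  shows "\<exists>a b. 2 * (a + b) \<le> p + 1 \<and> [a + t * b = z] (mod p)"
proof (cases "2 * z \<le> p + 1")
  case True
  then show ?thesis by (intro exI[of _ z] exI[of _ 0]) simp
next
  case z_large: False
  show ?thesis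
  proof (cases "2 * t \<le> p")
    case True
    \<comment> \<open>Here z is represented exactly. The product inequality below reads 2 q <= t q -
      t + 2, which with r <= t - 1 bounds 2 (r + q) by z + 1.\<close>
    define q r where "q = z div t" and "r = z mod t"
    have zqr: "z = t * q + r" and r: "r < t" using t by (auto simp: q_def r_def)
    have "2 * (r + q) \<le> p + 1"
    proof (cases "q = 0")
      case False
      then have "0 \<le> (int t - 2) * (int q - 1)" using t by simp
      then show ?thesis using zqr z r by (simp add: algebra_simps flip: of_nat_mult)
    qed (use r True in simp)
    moreover have "[r + t * q = z] (mod p)" by (simp add: zqr add.commute)
    ultimately show ?thesis by blast
  next
    case False
    \<comment> \<open>Modulo p, t is -s and z is -Q, so the equation becomes j s = Q + i:
      \<open>j\<close> is Q / s rounded up and \<open>i\<close> is the excess.\<close>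
    define s where "s = p - t"
    define Q where "Q = p - z"
    define j where "j = (Q + s - 1) div s"
    define i where "i = j * s - Q"
    have s: "2 \<le> s" "2 * s < p" "t = p - s" using t False by (auto simp: s_def)
    have Q: "1 \<le> Q" "2 * Q + 2 \<le> p" "z = p - Q" using z z_large by (auto simp: Q_def)
    obtain m where "m < s" "s * j + m = Q + s - 1"
      using s that[of "(Q + s - 1) mod s"] by (auto simp: j_def)
    then have i: "j * s = Q + i" "i < s"
      using Q s unfolding i_def by (auto simp: mult.commute)
    have j: "j \<noteq> 0" using i Q by (intro notI) simp
    have "2 * (i + j) \<le> p + 1"
    proof (cases "j = 1")
      case True
      then show ?thesis using i Q s by simp
    next
      case False
      then have "0 \<le> (int s - 2) * (int j - 2)" using s j by simp
      then show ?thesis using i Q s False j by (simp add: algebra_simps flip: of_nat_mult)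
    qed
    moreover have "[i + t * j = z] (mod p)"
    proof -
      have tz: "int t = int p - int s" "int z = int p - int Q"
        using s Q by simp_all
      have "int (i + t * j) - int z = int p * (int j - 1) + (int (Q + i) - int (j * s))"
        unfolding of_nat_add of_nat_mult tz by (simp add: algebra_simps)
      then have "int (i + t * j) - int z = int p * (int j - 1)" by (simp add: i(1))
      then have "int p dvd int (i + t * j) - int z" by simp
      then show ?thesis unfolding cong_int_iff[symmetric] cong_iff_dvd_diff .
    qed
    ultimately show ?thesis by blast
  qed
qed

text \<open>The lattice x + t y = 0 (mod p) has index p in Z^2, so two of its vectors with
  determinant p form a basis. Each case takes one short vector and obtains the other from a multiple
  of it by adding or subtracting (t, -1) or (p, 0). The lengths are bounded by products of two
  nonnegative factors, such as (i - 3) (t - 2).\<close>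

lemma small_lattice_basis:
  fixes p t :: nat
  assumes odd: "odd p" and t: "2 \<le> t" "t + 2 \<le> p"
  shows "\<exists>a b c e. 2 * (a + b) \<le> p + 3 \<and> 2 * (c + e) \<le> p + 3
    \<and> p dvd a + t * b \<and> p dvd c + t * e \<and> a * e = c * b + p"
proof -
  consider "3 * t \<le> p" | "2 * t \<le> p" "p < 3 * t" | "p < 2 * t" by linarith
  then show ?thesis
  proof cases
    case 1
    \<comment> \<open>The basis is (j + t, i - 1) and (j, i), both of weight exactly p.\<close>
    define i j where "i = p div t" and "j = p mod t"
    have pij: "p = t * i + j" "j < t" using t by (auto simp: i_def j_def)
    have "3 * t div t \<le> p div t" by (rule div_le_mono) (rule 1)
    then have i: "3 \<le> i" using t by (simp add: i_def)
    then obtain i' where i': "i = Suc i'" by (cases i) auto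
    have "0 \<le> (int i - 3) * (int t - 2)" using i t by simp
    then have "2 * (j + t + i') \<le> p + 3" "2 * (j + i) \<le> p + 3"
      using pij t by (simp_all add: i' algebra_simps flip: of_nat_mult)
    moreover have "j + t + t * i' = p" "j + t * i = p" by (simp_all add: pij(1) i')
    then have "p dvd j + t + t * i'" "p dvd j + t * i" by simp_all
    moreover have "(j + t) * i = j * i' + p" by (simp add: pij i' algebra_simps)
    ultimately show ?thesis by blast
  next
    case 2
    define j where "j = p mod t"
    have "p div t = 2" using 2 t by (intro div_nat_eqI) auto
    then have pj: "p = 2 * t + j" "j < t"
      using t div_mult_mod_eq[of p t] by (auto simp: j_def)
    show ?thesis
    \<comment> \<open>The short vector is (j, 2). For j = 1 the companion c (j, 2) - (t, -1) used
      below would be (0, p), which is too long; (1, 2) + (t, -1) replaces it.\<close>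
    proof (cases "j = 1")
      case True
      then have "p = 2 * t + 1" using pj by simp
      then have "2 * (t + 1 + 1) \<le> p + 3" "2 * (1 + 2) \<le> p + 3"
        "p = t + 1 + t * 1" "p = 1 + t * 2" "(t + 1) * 2 = 1 * 1 + p"
        using t by simp_all
      then show ?thesis by (metis dvd_refl)
    next
      case False
      have "odd j" using odd pj by simp
      then have j3: "3 \<le> j" using False by presburger
      \<comment> \<open>t / j rounded up: the least c for which c (j, 2) - (t, -1) has a nonnegative
        first coordinate, namely r.\<close>
      define c where "c = (t + j - 1) div j"
      obtain m where "m < j" "j * c + m = t + j - 1"
        using j3 that[of "(t + j - 1) mod j"] by (auto simp: c_def)
      then obtain r where r: "c * j = t + r" "r < j"
        using that[of "c * j - t"] j3 by (auto simp: mult.commute)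
      have c: "2 \<le> c"
      proof (rule ccontr)
        assume "\<not> 2 \<le> c"
        then have "c * j \<le> 1 * j" by (intro mult_right_mono) auto
        then show False using r pj by simp
      qed
      have "0 \<le> (int j - 3) * (int c - 2)" using c j3 by simp
      then have "2 * (r + (2 * c + 1)) \<le> p + 3"
        using r pj j3 by (simp add: algebra_simps flip: of_nat_mult)
      moreover have "2 * (j + 2) \<le> p + 3" using pj j3 by simp
      moreover have "r + t * (2 * c + 1) = p * c" using r by (simp add: pj algebra_simps)
      then have "p dvd r + t * (2 * c + 1)" by simp
      moreover have "p = j + t * 2" by (simp add: pj)
      then have "p dvd j + t * 2" by simp
      moreover have "j * (2 * c + 1) = r * 2 + p" using r by (simp add: pj algebra_simps)
      ultimately show ?thesis by blast
    qed
  next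
    case 3
    define s where "s = p - t"
    have s: "2 \<le> s" "2 * s < p" "p = t + s" using t 3 by (auto simp: s_def)
    \<comment> \<open>The short vector is (s, 1). As c is p / s rounded up, (r, c) = c (s, 1) - (p,
      0) is nonnegative with r < s.\<close>
    define c where "c = (p + s - 1) div s"
    obtain m where "m < s" "s * c + m = p + s - 1"
      using s that[of "(p + s - 1) mod s"] by (auto simp: c_def)
    then obtain r where r: "c * s = p + r" "r < s"
      using that[of "c * s - p"] s by (auto simp: mult.commute)
    have c: "3 \<le> c"
    proof (rule ccontr)
      assume "\<not> 3 \<le> c"
      then have "c * s \<le> 2 * s" by (intro mult_right_mono) auto
      then show False using r s by simp
    qed
    have "0 \<le> (int s - 2) * (int c - 3)" using c s by simp
    then have "2 * (r + c) \<le> p + 3"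
      using r s by (simp add: algebra_simps flip: of_nat_mult)
    moreover have "2 * (s + 1) \<le> p + 3" using s by simp
    moreover have "r + t * c + p = p * c" using r by (simp add: s algebra_simps)
    then have "p dvd r + t * c" by (metis dvd_add_left_iff dvd_refl dvd_triv_left)
    moreover have "p = s + t * 1" using s by simp
    then have "p dvd s + t * 1" by simp
    moreover have "s * c = r * 1 + p" using r by (simp add: mult.commute)
    ultimately show ?thesis by blast
  qed
qed

text \<open>Cramer's rule for the lattice basis: (x, y) = m (a, b) + n (c, e) with integers m and n.
  They may be negative, which is where closure under inverses enters.\<close>

lemma binomial_in_subgroup:
  fixes \<xi> \<eta> :: "'f::field" and p t :: nat
  assumes p: "odd p" and t: "2 \<le> t" "t + 2 \<le> p"
    and mult: "\<And>u v. u \<in> E \<Longrightarrow> v \<in> E \<Longrightarrow> u * v \<in> E"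
    and inverse: "\<And>u. u \<in> E \<Longrightarrow> inverse u \<in> E"
    and nz: "\<xi> \<noteq> 0" "\<eta> \<noteq> 0"
    and small: "\<And>a b. 2 * (a + b) \<le> p + 3 \<Longrightarrow> p dvd a + t * b \<Longrightarrow> \<xi> ^ a * \<eta> ^ b \<in> E"
    and xy: "p dvd x + t * y"
  shows "\<xi> ^ x * \<eta> ^ y \<in> E"
proof -
  have one: "1 \<in> E" using small[of 0 0] by simp
  have pow: "u ^ n \<in> E" if "u \<in> E" for u n
    using that by (induction n) (auto intro: one mult)
  have powi: "u powi m \<in> E" if "u \<in> E" for u m
    using pow[of u "nat m"] pow[OF inverse, of u "nat (-m)"] that by (auto simp: power_int_def)
  obtain a b c e where E: "\<xi> ^ a * \<eta> ^ b \<in> E" "\<xi> ^ c * \<eta> ^ e \<in> E"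
    and dvd: "p dvd a + t * b" "p dvd c + t * e" and det: "a * e = c * b + p"
    using small_lattice_basis[OF p t] small by metis
  have det': "int a * int e - int c * int b = int p"
    using arg_cong[OF det, of int] by simp
  have dvd': "int p dvd int x + int t * int y" "int p dvd int a + int t * int b"
    "int p dvd int c + int t * int e"
    using xy dvd by (simp_all flip: of_nat_mult of_nat_add)
  \<comment> \<open>Row operations show that the numerators in Cramer's rule are combinations of
    weights, hence divisible by the determinant p.\<close>
  have "int x * int e - int y * int c = (int x + int t * int y) * int e - int y * (int c + int t * int e)"
    "int a * int y - int b * int x = (int a + int t * int b) * int y - int b * (int x + int t * int y)"
    by (simp_all add: algebra_simps)
  then have "int p dvd int x * int e - int y * int c" "int p dvd int a * int y - int b * int x"
    using dvd' by (auto intro!: dvd_diff dvd_mult dvd_mult2)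
  then obtain m n where m: "int x * int e - int y * int c = int p * m"
    and n: "int a * int y - int b * int x = int p * n" by (auto simp: dvd_def)
  have p0: "int p \<noteq> 0" using t by simp
  have "int p * (int a * m + int c * n) = int a * (int p * m) + int c * (int p * n)"
    "int p * (int b * m + int e * n) = int b * (int p * m) + int e * (int p * n)"
    by (simp_all add: algebra_simps)
  then have "int p * (int a * m + int c * n) = (int a * int e - int c * int b) * int x"
    "int p * (int b * m + int e * n) = (int a * int e - int c * int b) * int y"
    unfolding m[symmetric] n[symmetric] by (simp_all add: algebra_simps)
  then have x: "int a * m + int c * n = int x" and y: "int b * m + int e * n = int y"
    using p0 by (auto simp: det')
  have "(\<xi> ^ a * \<eta> ^ b) powi m * (\<xi> ^ c * \<eta> ^ e) powi n =
      (\<xi> powi (int a * m) * \<xi> powi (int c * n)) * (\<eta> powi (int b * m) * \<eta> powi (int e * n))"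
    by (simp add: power_int_mult_distrib power_int_mult)
  also have "\<dots> = \<xi> ^ x * \<eta> ^ y"
    using nz by (simp add: x y flip: power_int_add)
  finally show ?thesis using E powi mult by metis
qed

text \<open>Every weight is minus the weight of a short monomial in \<open>\<xi> a\<close> and \<open>\<xi> b\<close>, so modulo
  \<open>E\<close> every monomial is the inverse of one in \<open>\<xi> a\<close> and \<open>\<xi> b\<close> alone.\<close>

lemma monomial_in_subgroup:
  fixes \<xi> :: "'i \<Rightarrow> 'f::field" and w :: "'i \<Rightarrow> nat" and p :: nat
  assumes p: "Factorial_Ring.prime p" "odd p"
    and ab: "a \<in> I" "b \<in> I" "\<not> p dvd w a" "\<not> p dvd w b"
      "\<not> [w a = w b] (mod p)" "\<not> p dvd w a + w b"
    and mult: "\<And>u v. u \<in> E \<Longrightarrow> v \<in> E \<Longrightarrow> u * v \<in> E"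
    and inverse: "\<And>u. u \<in> E \<Longrightarrow> inverse u \<in> E"
    and nz: "\<And>i. i \<in> I \<Longrightarrow> \<xi> i \<noteq> 0"
    and small: "\<And>M. set_mset M \<subseteq> I \<Longrightarrow> 2 * size M \<le> p + 3 \<Longrightarrow> p dvd (\<Sum>i\<in>#M. w i)
      \<Longrightarrow> (\<Prod>i\<in>#M. \<xi> i) \<in> E"
    and M: "set_mset M \<subseteq> I" "p dvd (\<Sum>i\<in>#M. w i)"
  shows "(\<Prod>i\<in>#M. \<xi> i) \<in> E"
proof -
  have p0: "p > 0" using p by (simp add: prime_gt_0_nat)
  have cop: "coprime (w a) p"
    using p(1) ab(3) by (metis prime_imp_coprime coprime_commute)
  then obtain v where v: "[w a * v = 1] (mod p)" using cong_solve_coprime_nat unfolding One_nat_def by blast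
  \<comment> \<open>The quotient of the two weights modulo p; the conditions on \<open>w a\<close>
    and \<open>w b\<close> keep it away from 0, 1 and p - 1.\<close>
  define t where "t = (w b * v) mod p"
  have t: "[w a * t = w b] (mod p)"
  proof -
    have "[w a * t = w a * (w b * v)] (mod p)" by (simp add: t_def cong_def mod_mult_right_eq)
    also have "w a * (w b * v) = w a * v * w b" by (simp add: ac_simps)
    also have "[w a * v * w b = 1 * w b] (mod p)" by (intro cong_mult v) simp
    finally show ?thesis by simp
  qed
  have weight: "[x * w a + y * w b = w a * (x + t * y)] (mod p)" for x y
  proof -
    have "[y * w b = y * (w a * t)] (mod p)" by (intro cong_mult cong_sym[OF t]) simp
    then have "[x * w a + y * w b = x * w a + y * (w a * t)] (mod p)" by (intro cong_add) simp
    then show ?thesis by (simp add: algebra_simps)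
  qed
  have "t \<noteq> 0" using t ab(4) by (intro notI) (simp add: cong_def dvd_eq_mod_eq_0)
  moreover have "t \<noteq> 1" using t ab(5) by (intro notI) simp
  moreover have "t \<noteq> p - 1"
  proof
    assume "t = p - 1"
    then have "w a * t + w a = w a * p"
      using p0 by (metis Suc_diff_1 mult_Suc_right add.commute)
    moreover have "[w a * t + w a = w b + w a] (mod p)" by (intro cong_add t) simp
    ultimately have "p dvd w b + w a" by (metis cong_dvd_iff dvd_triv_right)
    then show False using ab(6) by (simp add: add.commute)
  qed
  moreover have "t < p" using p0 by (simp add: t_def)
  ultimately have t_bounds: "2 \<le> t" "t + 2 \<le> p" by simp_all
  define N where "N x y = replicate_mset x a + replicate_mset y b" for x y :: nat
  have N: "set_mset (N x y) \<subseteq> I" "size (N x y) = x + y"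
    "(\<Sum>i\<in>#N x y. w i) = x * w a + y * w b" "(\<Prod>i\<in>#N x y. \<xi> i) = \<xi> a ^ x * \<xi> b ^ y" for x y
    using ab by (auto simp: N_def split: if_splits)
  have short: "\<exists>x y. 2 * (x + y) \<le> p + 1 \<and> [x * w a + y * w b = z] (mod p)" for z
  proof -
    obtain x y where xy: "2 * (x + y) \<le> p + 1" "[x + t * y = (v * z) mod p] (mod p)"
      using small_representative[OF p(2) t_bounds, of "(v * z) mod p"] p0 by auto
    have "[w a * (x + t * y) = w a * (v * z)] (mod p)"
      using xy(2) by (intro cong_mult) (simp_all add: cong_def)
    also have "w a * (v * z) = w a * v * z" by simp
    also have "[w a * v * z = 1 * z] (mod p)" by (intro cong_mult v) simp
    finally show ?thesis using xy(1) cong_trans[OF weight] by (metis mult_1)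
  qed
  have two: "\<xi> a ^ x * \<xi> b ^ y \<in> E" if xy: "p dvd x * w a + y * w b" for x y
  proof (rule binomial_in_subgroup[OF p(2) t_bounds, of E])
    show "\<xi> a ^ x' * \<xi> b ^ y' \<in> E" if "2 * (x' + y') \<le> p + 3" "p dvd x' + t * y'" for x' y'
      using small[of "N x' y'"] that weight[of x' y'] by (simp add: N cong_dvd_iff)
    have "p dvd w a * (x + t * y)" using xy weight[of x y] by (simp add: cong_dvd_iff)
    then show "p dvd x + t * y" using p(1) ab(3) by (simp add: prime_dvd_mult_iff)
  qed (use mult inverse nz ab in auto)
  have reduce: "\<exists>x y. [x * w a + y * w b + (\<Sum>i\<in>#M. w i) = 0] (mod p)
      \<and> (\<Prod>i\<in>#M. \<xi> i) * (\<xi> a ^ x * \<xi> b ^ y) \<in> E" if "set_mset M \<subseteq> I" for M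
    using that
  proof (induction M)
    case empty
    have "1 \<in> E" using small[of "{#}"] by simp
    then show ?case by (intro exI[of _ 0]) simp
  next
    case (add i M)
    then obtain x y where xy: "[x * w a + y * w b + (\<Sum>i\<in>#M. w i) = 0] (mod p)"
      "(\<Prod>i\<in>#M. \<xi> i) * (\<xi> a ^ x * \<xi> b ^ y) \<in> E" by auto
    \<comment> \<open>\<open>p * w i - w i\<close> is minus the weight of \<open>i\<close>, kept
      within the naturals. Together with \<open>\<xi> i\<close> the short monomial has at most (p +
      1) / 2 + 1 = (p + 3) / 2 factors, so \<open>small\<close> applies.\<close>
    obtain x' y' where xy': "2 * (x' + y') \<le> p + 1" "[x' * w a + y' * w b = p * w i - w i] (mod p)"
      using short by blast
    have "w i \<le> p * w i" using p0 by simp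
    then have "[x' * w a + y' * w b + w i = 0] (mod p)"
      using cong_add[OF xy'(2) cong_refl[of "w i"]] by (simp add: cong_def)
    moreover have "\<xi> i * (\<xi> a ^ x' * \<xi> b ^ y') \<in> E"
      using small[of "add_mset i (N x' y')"] calculation xy' add.prems
      by (simp add: N cong_0_iff add.commute)
    ultimately show ?case
      using mult[OF xy(2), of "\<xi> i * (\<xi> a ^ x' * \<xi> b ^ y')"]
        cong_add[OF xy(1), of "x' * w a + y' * w b + w i" 0]
      by (intro exI[of _ "x + x'"] exI[of _ "y + y'"])
        (simp add: power_add algebra_simps)
  qed
  obtain x y where xy: "[x * w a + y * w b + (\<Sum>i\<in>#M. w i) = 0] (mod p)"
    "(\<Prod>i\<in>#M. \<xi> i) * (\<xi> a ^ x * \<xi> b ^ y) \<in> E" using reduce[OF M(1)] by blast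
  have "p dvd x * w a + y * w b" using xy(1) M(2) by (simp add: cong_0_iff dvd_add_left_iff)
  then have "inverse (\<xi> a ^ x * \<xi> b ^ y) \<in> E" by (intro inverse two)
  moreover have "(\<Prod>i\<in>#M. \<xi> i) =
      (\<Prod>i\<in>#M. \<xi> i) * (\<xi> a ^ x * \<xi> b ^ y) * inverse (\<xi> a ^ x * \<xi> b ^ y)"
    using nz[OF ab(1)] nz[OF ab(2)] by (simp add: field_simps)
  ultimately show ?thesis using mult xy(2) by metis
qed

unbundle no fps_syntax

section \<open>Polynomials\<close>

lemma const_0 [simp]: "const 0 = 0"
  and const_1 [simp]: "const 1 = 1"
  and const_eq_0_iff [simp]: "const c = 0 \<longleftrightarrow> c = 0"
  and const_add: "const (a + b) = const a + const b"
  and const_mult: "const (a * b) = const a * const b"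
  by (auto simp: const_def single_add mult_single single_one[symmetric] simp del: single_one
      dest: arg_cong[of _ _ "\<lambda>f. Poly_Mapping.lookup f 0"])

lemma const_sum: "const (sum f A) = (\<Sum>x\<in>A. const (f x))"
  by (induction A rule: infinite_finite_induct) (simp_all add: const_add)

lemma const_of_nat: "const (of_nat n) = of_nat n"
  by (induction n) (simp_all add: const_add)

lemma poly_mapping_eq_sum_single:
  fixes f :: "'a \<Rightarrow>\<^sub>0 'b::comm_monoid_add"
  shows "f = (\<Sum>m\<in>Poly_Mapping.keys f. Poly_Mapping.single m (Poly_Mapping.lookup f m))"
proof (rule poly_mapping_eqI)
  fix k
  have "Poly_Mapping.lookup f k = (\<Sum>m\<in>Poly_Mapping.keys f. if m = k then Poly_Mapping.lookup f k else 0)"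
    by (simp add: in_keys_iff)
  also have "\<dots> = Poly_Mapping.lookup (\<Sum>m\<in>Poly_Mapping.keys f. Poly_Mapping.single m (Poly_Mapping.lookup f m)) k"
    by (auto simp: lookup_sum lookup_single when_def intro!: sum.cong)
  finally show "Poly_Mapping.lookup f k = \<dots>" .
qed

lemma poly_mapping_single_induct [case_names single add]:
  fixes f :: "'a \<Rightarrow>\<^sub>0 'b::comm_monoid_add"
  assumes "\<And>m c. P (Poly_Mapping.single m c)" and "\<And>f g. P f \<Longrightarrow> P g \<Longrightarrow> P (f + g)"
  shows "P f"
proof -
  have "P (\<Sum>m\<in>A. Poly_Mapping.single m (Poly_Mapping.lookup f m))" if "finite A" for A
    using that
  proof induction
    case empty
    show ?case using assms(1)[of undefined 0] by simp
  qed (simp add: assms)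
  then show ?thesis using poly_mapping_eq_sum_single[of f] by (metis finite_keys)
qed

lemma prod_coord_power:
  "(\<Prod>i\<in>A. coord i ^ k i) = Poly_Mapping.single (\<Sum>i\<in>A. Poly_Mapping.single i (k i)) (1 :: 'b::field)"
proof -
  have "(coord i :: ('a, 'b) polys) ^ n = Poly_Mapping.single (Poly_Mapping.single i n) 1" for i n
    by (induction n) (simp_all add: coord_def mult_single flip: single_add)
  then show ?thesis
    by (induction A rule: infinite_finite_induct) (simp_all add: mult_single)
qed

lemma single_eq_const_mult_coords:
  fixes m :: "'n::finite \<Rightarrow>\<^sub>0 nat"
  shows "Poly_Mapping.single m c = const c * (\<Prod>i\<in>UNIV. coord i ^ Poly_Mapping.lookup m i)"
proof -
  have "m = (\<Sum>i\<in>UNIV. Poly_Mapping.single i (Poly_Mapping.lookup m i))"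
    by (subst poly_mapping_eq_sum_single) (rule sum.mono_neutral_left, auto simp: in_keys_iff)
  then show ?thesis by (simp add: prod_coord_power const_def mult_single)
qed

text \<open>Reduces identities between ring homomorphisms to constants and coordinates.\<close>

lemma polys_induct [case_names const coord add mult]:
  fixes P :: "('n::finite, 'k::field) polys \<Rightarrow> bool"
  assumes "\<And>c. P (const c)" and "\<And>i. P (coord i)"
    and "\<And>f g. P f \<Longrightarrow> P g \<Longrightarrow> P (f + g)" and mult: "\<And>f g. P f \<Longrightarrow> P g \<Longrightarrow> P (f * g)"
  shows "P f"
proof (induction f rule: poly_mapping_single_induct)
  case (single m c)
  have one: "P 1" using assms(1)[of 1] by simp
  have "P (coord i ^ n)" for i n
    by (induction n) (simp_all add: one assms)
  then have "P (\<Prod>i\<in>A. coord i ^ Poly_Mapping.lookup m i)" for A :: "'n set"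
    by (induction A rule: infinite_finite_induct) (simp_all add: one mult)
  then show ?case by (simp add: single_eq_const_mult_coords assms)
qed (rule assms)

section \<open>Substitution\<close>

text \<open>The index set of the defining sum varies with the polynomial; a common superset allows
  the sums for f, g and f + g to be compared term by term.\<close>

lemma poly_subst_superset:
  assumes "finite A" "Poly_Mapping.keys f \<subseteq> A"
  shows "poly_subst s f =
    (\<Sum>m\<in>A. const (Poly_Mapping.lookup f m) * (\<Prod>i\<in>UNIV. s i ^ Poly_Mapping.lookup m i))"
  unfolding poly_subst_def
  by (rule sum.mono_neutral_left) (use assms in \<open>auto simp: in_keys_iff\<close>)

lemma poly_subst_single:
  "poly_subst s (Poly_Mapping.single m c) = const c * (\<Prod>i\<in>UNIV. s i ^ Poly_Mapping.lookup m i)"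
  by (subst poly_subst_superset[of "{m}"]) (auto split: if_splits)

lemma poly_subst_add: "poly_subst s (f + g) = poly_subst s f + poly_subst s g"
proof -
  let ?A = "Poly_Mapping.keys f \<union> Poly_Mapping.keys g"
  show ?thesis
    using keys_add[of f g]
    by (simp add: poly_subst_superset[of ?A] lookup_add const_add distrib_right sum.distrib)
qed

lemma poly_subst_mult: "poly_subst s (f * g) = poly_subst s f * poly_subst s g"
proof (induction f rule: poly_mapping_single_induct)
  case (single m c)
  show ?case
  proof (induction g rule: poly_mapping_single_induct)
    case (single m' c')
    show ?case
      by (simp add: mult_single poly_subst_single const_mult lookup_add power_add prod.distrib ac_simps)
  qed (simp add: poly_subst_add distrib_left)
qed (simp add: poly_subst_add distrib_right)

lemma poly_subst_const [simp]: "poly_subst s (const c) = const c"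
  by (simp add: const_def poly_subst_single)

lemma poly_subst_0 [simp]: "poly_subst s 0 = 0"
  and poly_subst_1 [simp]: "poly_subst s 1 = 1"
  using poly_subst_const[of s 0] poly_subst_const[of s 1] by simp_all

lemma poly_subst_coord [simp]: "poly_subst s (coord i) = s i"
proof -
  have "(\<Prod>j\<in>UNIV. s j ^ Poly_Mapping.lookup (Poly_Mapping.single i 1) j) = (\<Prod>j\<in>{i}. s j)"
    by (rule prod.mono_neutral_cong_right) (auto simp: lookup_single when_def)
  then show ?thesis by (simp add: coord_def poly_subst_single)
qed

lemma poly_subst_sum: "poly_subst s (sum f A) = (\<Sum>x\<in>A. poly_subst s (f x))"
  by (induction A rule: infinite_finite_induct) (simp_all add: poly_subst_add)

lemma poly_subst_prod: "poly_subst s (prod f A) = (\<Prod>x\<in>A. poly_subst s (f x))"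
  by (induction A rule: infinite_finite_induct) (simp_all add: poly_subst_mult)

lemma poly_subst_comp: "poly_subst s (poly_subst t f) = poly_subst (\<lambda>i. poly_subst s (t i)) f"
  by (induction f rule: polys_induct) (simp_all add: poly_subst_add poly_subst_mult)

lemma poly_subst_coords [simp]: "poly_subst coord f = f"
  by (induction f rule: polys_induct) (simp_all add: poly_subst_add poly_subst_mult)

text \<open>Pullback of functions along v -> M v; for M the matrix of the inverse of g it is the
  action of g.\<close>

definition linear_subst :: "'k::field ^ 'n ^ 'n \<Rightarrow> ('n::finite, 'k) polys \<Rightarrow> ('n, 'k) polys" where
  "linear_subst M = poly_subst (\<lambda>i. \<Sum>j\<in>UNIV. const (M $ i $ j) * coord j)"

lemma linear_subst_add: "linear_subst M (f + g) = linear_subst M f + linear_subst M g"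
  and linear_subst_mult: "linear_subst M (f * g) = linear_subst M f * linear_subst M g"
  and linear_subst_sum: "linear_subst M (sum h A) = (\<Sum>x\<in>A. linear_subst M (h x))"
  and linear_subst_prod: "linear_subst M (prod h A) = (\<Prod>x\<in>A. linear_subst M (h x))"
  and linear_subst_const [simp]: "linear_subst M (const c) = const c"
  and linear_subst_0 [simp]: "linear_subst M 0 = 0"
  and linear_subst_1 [simp]: "linear_subst M 1 = 1"
  and linear_subst_coord: "linear_subst M (coord i) = (\<Sum>j\<in>UNIV. const (M $ i $ j) * coord j)"
  by (simp_all add: linear_subst_def poly_subst_add poly_subst_mult poly_subst_sum poly_subst_prod)

text \<open>Pullback is contravariant, hence the reversed product.\<close>

lemma linear_subst_comp: "linear_subst A (linear_subst B f) = linear_subst (B ** A) f"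
proof -
  have "(\<Sum>j\<in>UNIV. const (B $ i $ j) * (\<Sum>k\<in>UNIV. const (A $ j $ k) * coord k)) =
      (\<Sum>k\<in>UNIV. const ((B ** A) $ i $ k) * coord k)" for i
  proof -
    have "(\<Sum>j\<in>UNIV. const (B $ i $ j) * (\<Sum>k\<in>UNIV. const (A $ j $ k) * coord k)) =
        (\<Sum>j\<in>UNIV. \<Sum>k\<in>UNIV. const (B $ i $ j) * const (A $ j $ k) * coord k)"
      by (simp add: sum_distrib_left mult.assoc)
    also have "\<dots> = (\<Sum>k\<in>UNIV. \<Sum>j\<in>UNIV. const (B $ i $ j) * const (A $ j $ k) * coord k)"
      by (rule sum.swap)
    finally show ?thesis
      by (simp add: matrix_matrix_mult_def const_sum const_mult sum_distrib_right)
  qed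
  then show ?thesis
    by (simp add: linear_subst_def poly_subst_comp poly_subst_sum poly_subst_mult)
qed

lemma linear_subst_id [simp]: "linear_subst (mat 1) f = (f :: ('b::finite, 'a::field) polys)"
proof -
  have "(\<Sum>j\<in>UNIV. const ((mat 1 :: 'a ^ 'b ^ 'b) $ i $ j) * coord j) = (\<Sum>j\<in>UNIV. if j = i then coord i else 0)" for i
    by (intro sum.cong) (auto simp: mat_def)
  then show ?thesis by (simp add: linear_subst_def)
qed

section \<open>Degree\<close>

lemma degree_le_const [simp]: "degree_le d (const c)"
  by (auto simp: degree_le_def const_def split: if_splits)

lemma degree_le_0 [simp]: "degree_le d 0" by (simp add: degree_le_def)

lemma degree_le_coord: "degree_le 1 (coord i)"
proof -
  have "(\<Sum>j\<in>UNIV. Poly_Mapping.lookup (Poly_Mapping.single i 1) j) = (\<Sum>j\<in>UNIV. if j = i then 1 else 0 :: nat)"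
    by (intro sum.cong) (auto simp: lookup_single when_def)
  then show ?thesis by (auto simp: degree_le_def coord_def)
qed

lemma degree_le_mono: "degree_le d f \<Longrightarrow> d \<le> e \<Longrightarrow> degree_le e f"
  by (auto simp: degree_le_def)

lemma degree_le_add: "degree_le d f \<Longrightarrow> degree_le d g \<Longrightarrow> degree_le d (f + g)"
  using keys_add[of f g] by (auto simp: degree_le_def)

lemma degree_le_sum: "(\<And>x. x \<in> A \<Longrightarrow> degree_le d (f x)) \<Longrightarrow> degree_le d (sum f A)"
  by (induction A rule: infinite_finite_induct) (auto intro: degree_le_add)

lemma degree_le_mult: "degree_le d f \<Longrightarrow> degree_le e g \<Longrightarrow> degree_le (d + e) (f * g)"
  using keys_mult[of f g] by (fastforce simp: degree_le_def lookup_add sum.distrib intro: add_mono)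

lemma degree_le_const_mult: "degree_le d f \<Longrightarrow> degree_le d (const c * f)"
  using degree_le_mult[of 0 "const c" d f] by simp

lemma degree_le_prod_mset: "(\<And>x. x \<in># A \<Longrightarrow> degree_le 1 (f x)) \<Longrightarrow> degree_le (size A) (\<Prod>x\<in>#A. f x)"
proof (induction A)
  case empty
  show ?case using degree_le_const[of 0 1] by simp
next
  case (add x A)
  then show ?case using degree_le_mult[of 1 "f x" "size A"] by simp
qed

lemma degree_le_linear_subst_coord: "degree_le 1 (linear_subst M (coord i))"
  unfolding linear_subst_coord by (intro degree_le_sum degree_le_const_mult degree_le_coord)

section \<open>Mapping the coefficients\<close>

lemma lookup_map_coeffs: "h 0 = 0 \<Longrightarrow> Poly_Mapping.lookup (Poly_Mapping.map h f) m = h (Poly_Mapping.lookup f m)"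
  by (simp add: map.rep_eq when_def)

lemma degree_le_map: "degree_le d f \<Longrightarrow> h 0 = 0 \<Longrightarrow> degree_le d (Poly_Mapping.map h f)"
  by (auto simp: degree_le_def in_keys_iff lookup_map_coeffs)

lemma map_coeffs_add:
  "h 0 = 0 \<Longrightarrow> (\<And>a b. h (a + b) = h a + h b)
    \<Longrightarrow> Poly_Mapping.map h (f + g) = Poly_Mapping.map h f + Poly_Mapping.map h g"
  by (intro poly_mapping_eqI) (simp add: lookup_map_coeffs lookup_add)

lemma map_coeffs_single: "h 0 = 0 \<Longrightarrow> Poly_Mapping.map h (Poly_Mapping.single m c) = Poly_Mapping.single m (h c)"
  by (intro poly_mapping_eqI) (simp add: lookup_map_coeffs lookup_single when_def)

locale field_ext =
  fixes \<iota> :: "'k::field \<Rightarrow> 'c::field"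
  assumes emb_1: "\<iota> 1 = 1"
    and emb_add: "\<iota> (a + b) = \<iota> a + \<iota> b" and emb_mult: "\<iota> (a * b) = \<iota> a * \<iota> b"
begin

lemma emb_0: "\<iota> 0 = 0" using emb_add[of 0 0] by (metis add.right_neutral add_left_cancel)

lemma emb_eq_0_iff: "\<iota> a = 0 \<longleftrightarrow> a = 0"
  using emb_mult[of a "inverse a"] emb_1 emb_0 by (cases "a = 0") auto

lemma emb_of_nat: "\<iota> (of_nat n) = of_nat n"
  by (induction n) (simp_all add: emb_0 emb_1 emb_add)

lemma emb_sum: "\<iota> (sum f A) = (\<Sum>x\<in>A. \<iota> (f x))"
  by (induction A rule: infinite_finite_induct) (simp_all add: emb_0 emb_add)

abbreviation lift :: "('n, 'k) polys \<Rightarrow> ('n, 'c) polys" where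
  "lift \<equiv> Poly_Mapping.map \<iota>"

lemma lift_single: "lift (Poly_Mapping.single m c) = Poly_Mapping.single m (\<iota> c)"
  by (simp add: map_coeffs_single emb_0)

lemma lift_const: "lift (const c) = const (\<iota> c)"
  and lift_coord: "lift (coord i) = coord i"
  by (simp_all add: const_def coord_def lift_single emb_1)

lemma lift_add: "lift (f + g) = lift f + lift g"
  by (simp add: map_coeffs_add emb_0 emb_add)

lemma lift_mult: "lift (f * g) = lift f * lift g"
proof (induction f rule: poly_mapping_single_induct)
  case (single m c)
  show ?case
    by (induction g rule: poly_mapping_single_induct)
      (simp_all add: mult_single lift_single emb_mult lift_add distrib_left)
qed (simp add: lift_add distrib_right)

lemma lift_0: "lift 0 = 0"
  by (intro poly_mapping_eqI) (simp add: lookup_map_coeffs emb_0)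

lemma lift_sum: "lift (sum f A) = (\<Sum>x\<in>A. lift (f x))"
  by (induction A rule: infinite_finite_induct) (simp_all add: lift_0 lift_add)

lemma lift_linear_subst:
  fixes M :: "'k ^ 'n::finite ^ 'n"
  shows "lift (linear_subst M f) = linear_subst (map_matrix \<iota> M) (lift f)"
  by (induction f rule: polys_induct)
    (simp_all add: lift_const lift_coord lift_add lift_mult linear_subst_add linear_subst_mult
      linear_subst_coord lift_sum)

lemma map_matrix_mult: "map_matrix \<iota> (A ** B) = map_matrix \<iota> A ** map_matrix \<iota> B"
  by (simp add: vec_eq_iff matrix_matrix_mult_def emb_sum emb_mult)

lemma map_matrix_mat_1: "map_matrix \<iota> (mat 1) = mat 1"
  by (simp add: vec_eq_iff mat_def emb_0 emb_1)

definition functional :: "('c \<Rightarrow> 'k) \<Rightarrow> bool" where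
  "functional \<phi> \<longleftrightarrow> (\<forall>x y. \<phi> (x + y) = \<phi> x + \<phi> y) \<and> (\<forall>a x. \<phi> (\<iota> a * x) = a * \<phi> x)"

context
  fixes \<phi> assumes \<phi>: "functional \<phi>"
begin

lemma functional_add: "\<phi> (x + y) = \<phi> x + \<phi> y" and functional_scale: "\<phi> (\<iota> a * x) = a * \<phi> x"
  using \<phi> by (auto simp: functional_def)

lemma functional_0: "\<phi> 0 = 0" using functional_scale[of 0 0] by simp

text \<open>Applied coefficientwise, \<open>\<phi>\<close> is linear over k[V], because the
  coefficients of \<open>lift f\<close> lie in the image of k. It need not respect products of two
  polynomials over K.\<close>

lemma map_functional_mult_lift:
  "Poly_Mapping.map \<phi> (F * lift f) = Poly_Mapping.map \<phi> F * f"
proof (induction F rule: poly_mapping_single_induct)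
  case (single m c)
  show ?case
  proof (induction f rule: poly_mapping_single_induct)
    case (single m' c')
    show ?case
      using functional_scale[of c' c]
      by (simp add: mult_single lift_single map_coeffs_single functional_0 mult.commute add.commute)
  qed (simp add: lift_add distrib_left map_coeffs_add functional_0 functional_add)
qed (simp add: distrib_right map_coeffs_add functional_0 functional_add)

lemma map_functional_const_mult_lift:
  "Poly_Mapping.map \<phi> (const c * lift f) = const (\<phi> c) * f"
  by (simp add: map_functional_mult_lift const_def map_coeffs_single functional_0)

text \<open>As the matrix has entries from k, \<open>\<phi>\<close> commutes with the action and so
  sends invariants over K to invariants over k.\<close>

lemma map_functional_linear_subst:
  fixes M :: "'k ^ 'n::finite ^ 'n"
  shows "Poly_Mapping.map \<phi> (linear_subst (map_matrix \<iota> M) F) = linear_subst M (Poly_Mapping.map \<phi> F)"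
proof (induction F rule: poly_mapping_single_induct)
  case (single m c)
  have "Poly_Mapping.single m c = const c * lift (Poly_Mapping.single m 1)"
    by (simp add: lift_single emb_1 const_def mult_single)
  then show ?case
    by (simp add: linear_subst_mult map_functional_const_mult_lift flip: lift_linear_subst)
qed (simp add: linear_subst_add map_coeffs_add functional_0 functional_add)

end
end

section \<open>Eigenforms over the extension field\<close>

inductive_set sums_of :: "'a::plus set \<Rightarrow> 'a set" for S where
  base: "x \<in> S \<Longrightarrow> x \<in> sums_of S"
| add: "x \<in> sums_of S \<Longrightarrow> y \<in> sums_of S \<Longrightarrow> x + y \<in> sums_of S"

lemma sums_of_mult:
  fixes S :: "'a::semiring set"
  assumes "\<And>x y. x \<in> S \<Longrightarrow> y \<in> S \<Longrightarrow> x * y \<in> S" "a \<in> sums_of S" "b \<in> sums_of S"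
  shows "a * b \<in> sums_of S"
  using assms(2)
proof induction
  case (base x)
  show ?case using assms(3)
    by induction (auto simp: distrib_left intro: sums_of.intros assms(1) base)
qed (auto simp: distrib_right intro: sums_of.add)

lemma sums_of_sum:
  fixes S :: "'a::comm_monoid_add set"
  assumes "0 \<in> S" "\<And>x. x \<in> A \<Longrightarrow> f x \<in> sums_of S"
  shows "sum f A \<in> sums_of S"
  using assms(2) by (induction A rule: infinite_finite_induct) (auto intro: sums_of.intros assms(1))

text \<open>Constants enter through the generators: the sets of invariants of bounded degree used
  for \<open>S\<close> contain them.\<close>

inductive_set subalgebra :: "'a::{plus, times} set \<Rightarrow> 'a set" for S where
  base: "x \<in> S \<Longrightarrow> x \<in> subalgebra S"
| add: "x \<in> subalgebra S \<Longrightarrow> y \<in> subalgebra S \<Longrightarrow> x + y \<in> subalgebra S"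
| mult: "x \<in> subalgebra S \<Longrightarrow> y \<in> subalgebra S \<Longrightarrow> x * y \<in> subalgebra S"

definition fractions :: "'a::idom set \<Rightarrow> 'a fract set" where
  "fractions B = {Fract a b | a b. a \<in> B \<and> b \<in> B \<and> b \<noteq> 0}"

lemma fractions_intro: "a \<in> B \<Longrightarrow> b \<in> B \<Longrightarrow> b \<noteq> 0 \<Longrightarrow> Fract a b \<in> fractions B"
  by (auto simp: fractions_def)

lemma fractions_closed:
  assumes "\<And>x y. x \<in> B \<Longrightarrow> y \<in> B \<Longrightarrow> x + y \<in> B" "\<And>x y. x \<in> B \<Longrightarrow> y \<in> B \<Longrightarrow> x * y \<in> B"
    "0 \<in> B" "1 \<in> B"
  shows "u \<in> fractions B \<Longrightarrow> v \<in> fractions B \<Longrightarrow> u + v \<in> fractions B"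
    and "u \<in> fractions B \<Longrightarrow> v \<in> fractions B \<Longrightarrow> u * v \<in> fractions B"
    and "u \<in> fractions B \<Longrightarrow> inverse u \<in> fractions B"
proof -
  show "inverse u \<in> fractions B" if u: "u \<in> fractions B"
  proof -
    obtain a b where ab: "u = Fract a b" "a \<in> B" "b \<in> B" "b \<noteq> 0"
      using u by (auto simp: fractions_def)
    show ?thesis
    \<comment> \<open>With the convention \<open>inverse 0 = 0\<close> closure under inverses is
      total, the form that \<open>monomial_in_subgroup\<close> asks of \<open>E\<close>.\<close>
    proof (cases "a = 0")
      case True
      then have "inverse u = Fract 0 1" using ab by (simp add: fract_collapse)
      then show ?thesis using assms by (auto intro: fractions_intro)
    qed (use ab in \<open>auto intro: fractions_intro\<close>)
  qed
  show "u + v \<in> fractions B" "u * v \<in> fractions B" if u: "u \<in> fractions B" and v: "v \<in> fractions B"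
  proof -
    obtain a b c d where "u = Fract a b" "a \<in> B" "b \<in> B" "b \<noteq> 0"
      "v = Fract c d" "c \<in> B" "d \<in> B" "d \<noteq> 0"
      using u v by (auto simp: fractions_def)
    then show "u + v \<in> fractions B" "u * v \<in> fractions B"
      by (auto intro!: fractions_intro assms(1,2))
  qed
qed

section \<open>Powers of a pth root of unity\<close>

lemma root_of_unity_power_eq_1_iff:
  fixes \<omega> :: "'a::field"
  assumes p: "Factorial_Ring.prime p" and \<omega>: "\<omega> ^ p = 1" "\<omega> \<noteq> 1"
  shows "\<omega> ^ g = 1 \<longleftrightarrow> p dvd g"
proof
  assume g: "\<omega> ^ g = 1"
  show "p dvd g"
  proof (rule ccontr)
    assume "\<not> p dvd g"
    \<comment> \<open>Some multiple of g is 1 modulo p, so \<open>\<omega>\<close> would be a power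
      of \<open>\<omega> ^ g\<close> and thus equal to 1.\<close>
    then have "coprime g p" using p by (metis prime_imp_coprime coprime_commute)
    then obtain v where "[g * v = 1] (mod p)"
      using cong_solve_coprime_nat unfolding One_nat_def by blast
    then obtain q r where "g * v + q * p = 1 + r * p" by (metis cong_iff_lin_nat)
    moreover have "\<omega> ^ (g * v + q * p) = 1"
      using g \<omega> by (simp add: power_add power_mult mult.commute[of q])
    moreover have "\<omega> ^ (1 + r * p) = \<omega>"
      using \<omega> by (simp add: power_add power_mult mult.commute[of r])
    ultimately show False using \<omega> by simp
  qed
qed (use \<omega> in \<open>auto simp: power_mult\<close>)

lemma sum_root_of_unity_powers:
  fixes \<omega> :: "'a::field"
  assumes p: "Factorial_Ring.prime p" and \<omega>: "\<omega> ^ p = 1" "\<omega> \<noteq> 1"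
  shows "(\<Sum>j<p. \<omega> ^ (g * j)) = (if p dvd g then of_nat p else 0)"
proof (cases "p dvd g")
  case True
  then have "\<omega> ^ (g * j) = 1" for j
    using root_of_unity_power_eq_1_iff[OF assms] by simp
  then show ?thesis using True by simp
next
  case False
  then have "\<omega> ^ g \<noteq> 1" using root_of_unity_power_eq_1_iff[OF assms] by simp
  moreover have "(\<omega> ^ g) ^ p = 1" using \<omega> by (metis power_mult mult.commute power_one)
  ultimately show ?thesis using False by (simp add: power_mult sum_gp_strict)
qed

text \<open>\<open>M\<close> stands for one generator of the group. Over a field with p nonzero that
  contains \<zeta>, x^p - 1 has p distinct roots, so a linear map of period p is
  diagonalizable.\<close>

locale diagonalizable =
  fixes p :: nat and M :: "'c::field ^ 'n::{finite, linorder} ^ 'n::{finite, linorder}" and \<zeta> :: 'c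
  assumes prime: "Factorial_Ring.prime p" and p_nz: "(of_nat p :: 'c) \<noteq> 0"
    and root: "\<zeta> ^ p = 1" "\<zeta> \<noteq> 1"
    and period: "(linear_subst M ^^ p) f = f"
begin

abbreviation \<Phi> :: "('n, 'c) polys \<Rightarrow> ('n, 'c) polys" where "\<Phi> \<equiv> linear_subst M"

lemma \<Phi>_pow_add: "(\<Phi> ^^ g) (a + b) = (\<Phi> ^^ g) a + (\<Phi> ^^ g) b"
  and \<Phi>_pow_mult: "(\<Phi> ^^ g) (a * b) = (\<Phi> ^^ g) a * (\<Phi> ^^ g) b"
  and \<Phi>_pow_const: "(\<Phi> ^^ g) (const c) = const c"
  by (induction g) (simp_all add: linear_subst_add linear_subst_mult)

lemma \<zeta>_nz: "\<zeta> \<noteq> 0"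
  using root prime by (auto simp: prime_gt_0_nat power_0_left split: if_splits)

lemma inverse_root: "inverse \<zeta> ^ p = 1" "inverse \<zeta> \<noteq> 1"
  using root by (auto simp: power_inverse)

text \<open>A discrete Fourier transform: up to the factor p, the projection of coordinate i to the
  eigenspace of \<open>\<Phi>\<close> for \<zeta>^j, where the index is (i, j). These forms span but
  may vanish or be dependent.\<close>

definition eigenform :: "'n \<times> nat \<Rightarrow> ('n, 'c) polys" where
  "eigenform x = (\<Sum>g<p. const (inverse \<zeta> ^ (snd x * g)) * (\<Phi> ^^ g) (coord (fst x)))"

text \<open>\<open>\<Phi>\<close> turns summand g into summand g + 1 times \<zeta>^j, and
  periodicity closes the cycle.\<close>

lemma \<Phi>_eigenform: "\<Phi> (eigenform x) = const (\<zeta> ^ snd x) * eigenform x"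
proof -
  define h where "h g = const (inverse \<zeta> ^ (snd x * g)) * (\<Phi> ^^ g) (coord (fst x))" for g
  have step: "\<Phi> (h g) = const (\<zeta> ^ snd x) * h (Suc g)" for g
  proof -
    have "\<zeta> ^ snd x * inverse \<zeta> ^ (snd x * Suc g) = inverse \<zeta> ^ (snd x * g)"
      using \<zeta>_nz by (simp add: power_add power_inverse)
    then show ?thesis
      by (simp add: h_def linear_subst_mult mult.assoc[symmetric] flip: const_mult)
  qed
  have "h p = h 0"
    using inverse_root by (simp add: h_def period power_mult mult.commute[of _ p])
  then have "(\<Sum>g<p. h (Suc g)) = (\<Sum>g<p. h g)"
    using sum.lessThan_Suc_shift[of h p] by (simp add: add.commute)
  then show ?thesis
    by (simp add: eigenform_def linear_subst_sum step flip: h_def sum_distrib_left)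
qed

text \<open>Fourier inversion: summing over all weights leaves only the term g = 0.\<close>

lemma coord_eq_sum_eigenforms: "coord i = const (inverse (of_nat p)) * (\<Sum>j<p. eigenform (i, j))"
proof -
  have "(\<Sum>j<p. eigenform (i, j)) = (\<Sum>g<p. const (\<Sum>j<p. inverse \<zeta> ^ (g * j)) * (\<Phi> ^^ g) (coord i))"
    unfolding eigenform_def fst_conv snd_conv
    by (subst sum.swap) (simp add: const_sum sum_distrib_left mult.commute)
  also have "\<dots> = (\<Sum>g<p. if g = 0 then const (of_nat p) * coord i else 0)"
    using sum_root_of_unity_powers[OF prime inverse_root]
    by (intro sum.cong) (auto dest: dvd_imp_le)
  also have "\<dots> = const (of_nat p) * coord i" using prime by (simp add: prime_gt_0_nat)
  finally show ?thesis using p_nz by (simp add: mult.assoc[symmetric] flip: const_mult)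
qed

lemma degree_le_eigenform: "degree_le 1 (eigenform x)"
proof -
  have "degree_le 1 ((\<Phi> ^^ g) (coord i))" for g i
  proof -
    have "\<exists>A. \<forall>f. (\<Phi> ^^ g) f = linear_subst A f"
    proof (induction g)
      case 0
      show ?case by (intro exI[of _ "mat 1"]) simp
    qed (auto simp: linear_subst_comp)
    then show ?thesis by (metis degree_le_linear_subst_coord)
  qed
  then show ?thesis unfolding eigenform_def by (intro degree_le_sum degree_le_const_mult)
qed

lemma \<Phi>_eigenmonomial:
  "(\<Phi> ^^ g) (\<Prod>x\<in>#A. eigenform x) = const (\<zeta> ^ ((\<Sum>x\<in>#A. snd x) * g)) * (\<Prod>x\<in>#A. eigenform x)"
proof (induction g)
  case (Suc g)
  have "\<Phi> (\<Prod>x\<in>#A. eigenform x) = const (\<zeta> ^ (\<Sum>x\<in>#A. snd x)) * (\<Prod>x\<in>#A. eigenform x)"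
    by (induction A) (simp_all add: linear_subst_mult \<Phi>_eigenform power_add const_mult ac_simps)
  with Suc show ?case by (simp add: linear_subst_mult power_add const_mult ac_simps)
qed simp

lemma polys_spanned_by_eigenmonomials:
  "f \<in> sums_of {const c * (\<Prod>x\<in>#A. eigenform x) | c A. True}" (is "f \<in> sums_of ?S")
proof -
  have mult_closed: "a * b \<in> ?S" if "a \<in> ?S" "b \<in> ?S" for a b
  proof -
    obtain c A d B where "a = const c * (\<Prod>x\<in>#A. eigenform x)" "b = const d * (\<Prod>x\<in>#B. eigenform x)"
      using \<open>a \<in> ?S\<close> \<open>b \<in> ?S\<close> by auto
    then have "a * b = const (c * d) * (\<Prod>x\<in>#A + B. eigenform x)"
      by (simp add: const_mult ac_simps)
    then show ?thesis by blast
  qed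
  have const_mem: "const c \<in> ?S" for c
    by (auto intro!: exI[of _ c] exI[of _ "{#}"])
  have zero: "0 \<in> ?S" using const_mem[of 0] unfolding const_0 .
  show ?thesis
  proof (induction f rule: polys_induct)
    case (coord i)
    have "eigenform x \<in> ?S" for x by (auto intro!: exI[of _ 1] exI[of _ "{#x#}"])
    note eigenform = sums_of.base[OF this]
    then show ?case unfolding coord_eq_sum_eigenforms[of i]
      by (intro sums_of_mult[OF mult_closed] sums_of_sum zero eigenform sums_of.base[OF const_mem])
  next
    case (const c)
    show ?case by (rule sums_of.base[OF const_mem])
  next
    case (mult f g)
    then show ?case by (intro sums_of_mult[OF mult_closed])
  qed (rule sums_of.add)
qed

text \<open>The Reynolds operator kills the monomials of nonzero weight.\<close>

lemma invariant_spanned_by_invariant_eigenmonomials: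
  assumes "\<Phi> f = f"
  shows "f \<in> sums_of {const c * (\<Prod>x\<in>#A. eigenform x) | c A.
    p dvd (\<Sum>x\<in>#A. snd x) \<and> (\<forall>x\<in>#A. eigenform x \<noteq> 0)}" (is "_ \<in> sums_of ?T")
proof -
  have zero: "0 \<in> ?T" by (auto intro!: exI[of _ 0] exI[of _ "{#}"])
  define R where "R f = const (inverse (of_nat p)) * (\<Sum>g<p. (\<Phi> ^^ g) f)" for f
  have R_add: "R (a + b) = R a + R b" for a b
    by (simp add: R_def \<Phi>_pow_add sum.distrib distrib_left)
  have "R f \<in> sums_of ?T"
    using polys_spanned_by_eigenmonomials[of f]
  proof induction
    case (base f)
    then obtain c A where f: "f = const c * (\<Prod>x\<in>#A. eigenform x)" by auto
    have "R f = const (inverse (of_nat p) * (\<Sum>g<p. \<zeta> ^ ((\<Sum>x\<in>#A. snd x) * g))) * f"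
      by (simp add: R_def f \<Phi>_pow_mult \<Phi>_pow_const \<Phi>_eigenmonomial const_mult const_sum
          sum_distrib_left sum_distrib_right ac_simps)
    also have "\<dots> = (if p dvd (\<Sum>x\<in>#A. snd x) then f else 0)"
      using p_nz by (simp add: sum_root_of_unity_powers[OF prime root])
    also have "\<dots> \<in> ?T"
    \<comment> \<open>A product with a vanishing factor is zero and is rewritten as 0 times the
      empty product. Only nonzero eigenforms remain, so they can be inverted later.\<close>
    proof (cases "f = 0 \<or> \<not> p dvd (\<Sum>x\<in>#A. snd x)")
      case False
      then have "\<forall>x\<in>#A. eigenform x \<noteq> 0"
        unfolding f by (auto simp: image_iff)
      with False show ?thesis unfolding f by auto
    next
      case True
      then have "(if p dvd (\<Sum>x\<in>#A. snd x) then f else 0) = 0" by auto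
      then show ?thesis using zero by (simp only:)
    qed
    finally show ?case by (rule sums_of.base)
  qed (auto simp: R_add intro: sums_of.add)
  moreover have "(\<Phi> ^^ g) f = f" for g by (induction g) (simp_all add: assms)
  then have "(\<Sum>g<p. (\<Phi> ^^ g) f) = const (of_nat p) * f"
    by (induction p) (simp_all add: const_add distrib_right add.commute)
  then have "R f = f" using p_nz by (simp add: R_def mult.assoc[symmetric] flip: const_mult)
  ultimately show ?thesis by simp
qed

text \<open>At the point v the powers of \<zeta> cancel, and the form of index (i, j) takes the
  value p times the i-th coordinate of v.\<close>

lemma eigenform_nonzero:
  assumes v: "v \<noteq> 0" "M *v v = \<zeta> ^ j *s v"
  shows "\<exists>i. eigenform (i, j) \<noteq> 0"
proof -
  obtain i where i: "v $ i \<noteq> 0" using v(1) by (auto simp: vec_eq_iff)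
  \<comment> \<open>Evaluation at \<open>u\<close>, written as a substitution of constants so that
    \<open>poly_subst_comp\<close> moves \<open>\<Phi>\<close> over to the point.\<close>
  define ev where "ev u = poly_subst (\<lambda>i. const (u $ i) :: ('n, 'c) polys)" for u :: "('c, 'n) vec"
  have ev_\<Phi>: "ev u (\<Phi> f) = ev (M *v u) f" for u f
    by (simp add: ev_def linear_subst_def poly_subst_comp poly_subst_sum poly_subst_mult
        matrix_vector_mult_def const_sum const_mult)
  have "M *v u = c *s u \<Longrightarrow> ev u ((\<Phi> ^^ g) (coord i)) = const (c ^ g * u $ i)" for u c g
  proof (induction g arbitrary: u)
    case (Suc g)
    have "M *v (c *s u) = c *s (c *s u)" using Suc.prems by (simp add: vector_scalar_commute)
    from Suc.IH[OF this] show ?case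
      using Suc.prems by (simp add: ev_\<Phi> ac_simps)
  qed (simp add: ev_def)
  from this[OF v(2)] have "ev v (eigenform (i, j)) =
      (\<Sum>g<p. const ((inverse \<zeta> * \<zeta>) ^ (j * g) * v $ i))"
    by (simp add: eigenform_def ev_def poly_subst_sum poly_subst_mult const_mult power_mult_distrib
        ac_simps flip: power_mult)
  also have "\<dots> = const (of_nat p * v $ i)"
    using \<zeta>_nz by (simp add: const_mult const_of_nat)
  finally have "ev v (eigenform (i, j)) \<noteq> 0" using i p_nz by simp
  then have "eigenform (i, j) \<noteq> 0" by (auto simp: ev_def)
  then show ?thesis ..
qed

text \<open>The group \<open>E\<close> of \<open>monomial_in_subgroup\<close> is here the fraction
  field of the algebra of low-degree invariants. Denominators are cleared because a functional can
  be applied to f D = N but not to a quotient.\<close>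

lemma invariant_in_fractions:
  assumes "odd p" and "\<Phi> f = f"
    and ab: "eigenform a \<noteq> 0" "eigenform b \<noteq> 0" "\<not> p dvd snd a" "\<not> p dvd snd b"
      "\<not> [snd a = snd b] (mod p)" "\<not> p dvd snd a + snd b"
  shows "\<exists>D N. D \<in> subalgebra {f. degree_le ((p + 3) div 2) f \<and> \<Phi> f = f}
    \<and> N \<in> subalgebra {f. degree_le ((p + 3) div 2) f \<and> \<Phi> f = f} \<and> D \<noteq> 0 \<and> f * D = N"
proof -
  define B where "B = subalgebra {f. degree_le ((p + 3) div 2) f \<and> \<Phi> f = f}"
  have const: "const c \<in> B" for c unfolding B_def by (rule subalgebra.base) simp
  have B: "0 \<in> B" "1 \<in> B" using const[of 0] const[of 1] by simp_all
  have B_add: "x + y \<in> B" and B_mult: "x * y \<in> B" if "x \<in> B" "y \<in> B" for x y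
    using that unfolding B_def by (auto intro: subalgebra.intros)
  have E: "u + v \<in> fractions B" "u * v \<in> fractions B" "inverse u \<in> fractions B"
    if "u \<in> fractions B" "v \<in> fractions B" for u v
    using that by (auto intro: fractions_closed B_add B_mult B)
  have poly: "Fract h 1 \<in> fractions B" if "h \<in> B" for h
    using that B by (intro fractions_intro) auto
  have prod: "(\<Prod>x\<in>#A. Fract (eigenform x) 1) = Fract (\<Prod>x\<in>#A. eigenform x) 1" for A
    by (induction A) (simp_all add: One_fract_def)
  have monomial: "Fract (\<Prod>x\<in>#A. eigenform x) 1 \<in> fractions B"
    if "p dvd (\<Sum>x\<in>#A. snd x)" "\<forall>x\<in>#A. eigenform x \<noteq> 0" for A
    unfolding prod[symmetric]
  proof (rule monomial_in_subgroup[of p a "{x. eigenform x \<noteq> 0}" b snd "fractions B"])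
    fix A :: "('n \<times> nat) multiset"
    assume A: "2 * size A \<le> p + 3" "p dvd (\<Sum>x\<in>#A. snd x)"
    have "degree_le ((p + 3) div 2) (\<Prod>x\<in>#A. eigenform x)"
      by (rule degree_le_mono[OF degree_le_prod_mset]) (use A degree_le_eigenform in auto)
    moreover have "\<zeta> ^ (\<Sum>x\<in>#A. snd x) = 1"
      using A root_of_unity_power_eq_1_iff[OF prime root] by simp
    then have "\<Phi> (\<Prod>x\<in>#A. eigenform x) = (\<Prod>x\<in>#A. eigenform x)"
      using \<Phi>_eigenmonomial[of 1 A] by simp
    ultimately show "(\<Prod>x\<in>#A. Fract (eigenform x) 1) \<in> fractions B"
      unfolding prod by (intro poly) (auto simp: B_def intro: subalgebra.base)
  qed (use prime assms that E(2) E(3)[OF _ poly[OF B(1)]] in \<open>simp_all add: Zero_fract_def eq_fract subset_iff\<close>)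
  have "Fract f 1 \<in> fractions B"
    using invariant_spanned_by_invariant_eigenmonomials[OF assms(2)]
  proof induction
    case (base f)
    then obtain c A where f: "f = const c * (\<Prod>x\<in>#A. eigenform x)"
      "p dvd (\<Sum>x\<in>#A. snd x)" "\<forall>x\<in>#A. eigenform x \<noteq> 0" by auto
    have eq: "Fract f 1 = Fract (const c) 1 * Fract (\<Prod>x\<in>#A. eigenform x) 1" by (simp add: f)
    show ?case unfolding eq by (intro E(2) poly[OF const] monomial f(2,3))
  next
    case (add f g)
    have eq: "Fract (f + g) 1 = Fract f 1 + Fract g 1" by simp
    show ?case unfolding eq by (rule E(1)) fact+
  qed
  then obtain N D where "Fract f 1 = Fract N D" "N \<in> B" "D \<in> B" "D \<noteq> 0"
    by (auto simp: fractions_def)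
  then show ?thesis by (auto simp: eq_fract B_def)
qed

end

section \<open>Descent to the base field\<close>

lemma lookup_const_mult: "Poly_Mapping.lookup (const c * f) m = c * Poly_Mapping.lookup f m"
  by (simp add: const_def lookup_map_coeffs flip: mult_map_scale_conv_mult)

context field_ext
begin

text \<open>K may have infinite dimension over k, but finitely many scalars involve only finitely
  many elements of a basis; the \<open>\<psi> b\<close> are coordinate functionals.\<close>

lemma finite_expansion:
  assumes "finite S"
  shows "\<exists>B \<psi>. finite B \<and> (\<forall>b. functional (\<psi> b)) \<and> (\<forall>x\<in>S. x = (\<Sum>b\<in>B. b * \<iota> (\<psi> b x)))"
proof -
  interpret vs: vector_space "\<lambda>a x. \<iota> a * x"
    by unfold_locales (simp_all add: emb_1 emb_add emb_mult algebra_simps)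
  define C where "C = vs.extend_basis {}"
  have C: "vs.independent C" "x \<in> vs.span C" for x
    using vs.independent_extend_basis[OF vs.independent_empty]
      vs.span_extend_basis[OF vs.independent_empty] by (auto simp: C_def)
  define \<psi> where "\<psi> b x = vs.representation C x b" for b x
  define B where "B = (\<Union>x\<in>S. {b. \<psi> b x \<noteq> 0})"
  have "finite B" using assms vs.finite_representation by (auto simp: B_def \<psi>_def)
  moreover have "functional (\<psi> b)" for b
    using C by (auto simp: functional_def \<psi>_def vs.representation_add vs.representation_scale)
  moreover have "x = (\<Sum>b\<in>B. b * \<iota> (\<psi> b x))" if x: "x \<in> S" for x
  proof -
    have "x = (\<Sum>b | \<psi> b x \<noteq> 0. \<iota> (\<psi> b x) * b)"
      using vs.sum_nonzero_representation_eq[OF C] by (simp add: \<psi>_def)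
    also have "\<dots> = (\<Sum>b\<in>B. \<iota> (\<psi> b x) * b)"
      using x \<open>finite B\<close> by (intro sum.mono_neutral_left) (auto simp: B_def emb_0)
    finally show ?thesis by (simp add: mult.commute)
  qed
  ultimately show ?thesis by blast
qed

lemma functional_nonzero:
  assumes "c \<noteq> 0"
  shows "\<exists>\<phi>. functional \<phi> \<and> \<phi> c \<noteq> 0"
proof -
  obtain B \<psi> where B: "\<And>b. functional (\<psi> b)" "c = (\<Sum>b\<in>B. b * \<iota> (\<psi> b c))"
    using finite_expansion[of "{c}"] by auto
  have "\<exists>b\<in>B. \<psi> b c \<noteq> 0"
  proof (rule ccontr)
    assume "\<not> ?thesis"
    then have "(\<Sum>b\<in>B. b * \<iota> (\<psi> b c)) = 0" by (simp add: emb_0)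
    with B(2) assms show False by simp
  qed
  with B(1) show ?thesis by blast
qed

lemma polys_finite_expansion:
  fixes F :: "('n, 'c) polys"
  shows "\<exists>B \<psi>. finite B \<and> (\<forall>b. functional (\<psi> b)) \<and>
    F = (\<Sum>b\<in>B. const b * lift (Poly_Mapping.map (\<psi> b) F))"
proof -
  \<comment> \<open>0 is included because it is the coefficient at every exponent outside the
    keys.\<close>
  define S where "S = insert 0 (Poly_Mapping.lookup F ` Poly_Mapping.keys F)"
  have "finite S" by (simp add: S_def)
  from finite_expansion[OF this] obtain B \<psi> where B: "finite B" "\<And>b. functional (\<psi> b)"
    "\<And>x. x \<in> S \<Longrightarrow> x = (\<Sum>b\<in>B. b * \<iota> (\<psi> b x))"
    by blast
  have "F = (\<Sum>b\<in>B. const b * lift (Poly_Mapping.map (\<psi> b) F))"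
  proof (rule poly_mapping_eqI)
    fix m
    have "Poly_Mapping.lookup F m \<in> S"
      by (auto simp: S_def in_keys_iff)
    from B(3)[OF this] show "Poly_Mapping.lookup F m =
        Poly_Mapping.lookup (\<Sum>b\<in>B. const b * lift (Poly_Mapping.map (\<psi> b) F)) m"
      by (simp add: lookup_sum lookup_const_mult lookup_map_coeffs emb_0 functional_0[OF B(2)])
  qed
  with B show ?thesis by blast
qed

context
  fixes M :: "'k ^ 'n::{finite, linorder} ^ 'n::{finite, linorder}" and d :: nat and I I'
  defines "I \<equiv> {f. degree_le d f \<and> linear_subst M f = f}"
    and "I' \<equiv> {f. degree_le d f \<and> linear_subst (map_matrix \<iota> M) f = f}"
begin

text \<open>Invariance is a linear condition over k, so the components of an invariant along a basis
  of K over k are invariant; products of such expansions have the same shape.\<close>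

lemma subalgebra_extension:
  assumes "F \<in> subalgebra I'"
  shows "F \<in> sums_of {const c * lift h | c h. h \<in> subalgebra I}" (is "_ \<in> sums_of ?S")
  using assms
proof induction
  case (base F)
  then have F: "degree_le d F" "linear_subst (map_matrix \<iota> M) F = F" by (auto simp: I'_def)
  obtain B \<psi> where B: "finite B" "\<And>b. functional (\<psi> b)"
    "F = (\<Sum>b\<in>B. const b * lift (Poly_Mapping.map (\<psi> b) F))"
    using polys_finite_expansion[of F] by blast
  have I: "Poly_Mapping.map (\<psi> b) F \<in> subalgebra I" for b
  proof (rule subalgebra.base)
    show "Poly_Mapping.map (\<psi> b) F \<in> I"
      using F map_functional_linear_subst[OF B(2), of b M F]
      by (simp add: I_def degree_le_map functional_0[OF B(2)])
  qed
  have "0 \<in> I" by (simp add: I_def)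
  then have "0 \<in> subalgebra I" by (rule subalgebra.base)
  then have zero: "0 \<in> ?S" by (auto intro!: exI[of _ 0])
  have "const b * lift (Poly_Mapping.map (\<psi> b) F) \<in> sums_of ?S" for b
    using I by (intro sums_of.base) blast
  then have "(\<Sum>b\<in>B. const b * lift (Poly_Mapping.map (\<psi> b) F)) \<in> sums_of ?S"
    by (intro sums_of_sum zero)
  with B(3) show ?case by metis
next
  case (mult F G)
  have "a * b \<in> ?S" if "a \<in> ?S" "b \<in> ?S" for a b
  proof -
    obtain c h e g where "a = const c * lift h" "b = const e * lift g"
      "h \<in> subalgebra I" "g \<in> subalgebra I"
      using \<open>a \<in> ?S\<close> \<open>b \<in> ?S\<close> by auto
    moreover from this have "a * b = const (c * e) * lift (h * g)"
      by (simp add: const_mult lift_mult ac_simps)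
    ultimately show ?thesis by (blast intro: subalgebra.mult)
  qed
  from sums_of_mult[OF this mult.IH] show ?case .
qed (rule sums_of.add)

lemma map_functional_subalgebra:
  assumes \<phi>: "functional \<phi>" and F: "F \<in> subalgebra I'"
  shows "Poly_Mapping.map \<phi> F \<in> subalgebra I"
  using subalgebra_extension[OF F]
proof induction
  case (base F)
  then obtain c h where F: "F = const c * lift h" "h \<in> subalgebra I" by blast
  have "const (\<phi> c) \<in> subalgebra I"
    by (rule subalgebra.base) (simp add: I_def)
  with F show ?case
    by (simp add: map_functional_const_mult_lift[OF \<phi>] subalgebra.mult)
next
  case (add F G)
  then show ?case
    by (simp add: map_coeffs_add functional_0[OF \<phi>] functional_add[OF \<phi>] subalgebra.add)
qed

lemma descend_fraction:
  assumes "D \<in> subalgebra I'" "lift f * D \<in> subalgebra I'" "D \<noteq> 0"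
  shows "\<exists>D\<in>subalgebra I. D \<noteq> 0 \<and> f * D \<in> subalgebra I"
proof -
  \<comment> \<open>A functional that is nonzero on some coefficient of D keeps the new denominator
    from vanishing.\<close>
  obtain m where "Poly_Mapping.lookup D m \<noteq> 0"
    using assms(3) by (metis lookup_zero poly_mapping_eqI)
  then obtain \<phi> where \<phi>: "functional \<phi>" "\<phi> (Poly_Mapping.lookup D m) \<noteq> 0"
    using functional_nonzero by blast
  have "Poly_Mapping.lookup (Poly_Mapping.map \<phi> D) m \<noteq> 0"
    using \<phi> by (simp add: lookup_map_coeffs functional_0[OF \<phi>(1)])
  then have "Poly_Mapping.map \<phi> D \<noteq> 0" by auto
  moreover have "Poly_Mapping.map \<phi> (lift f * D) = f * Poly_Mapping.map \<phi> D"
    using map_functional_mult_lift[OF \<phi>(1), of D f] by (simp add: mult.commute)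
  ultimately show ?thesis
    using map_functional_subalgebra[OF \<phi>(1)] assms(1,2) by metis
qed

end
end

section \<open>The field of invariants\<close>

lemma ring_of_type_algebra_simps [simp]:
  "carrier ring_of_type_algebra = UNIV"
  "\<one>\<^bsub>ring_of_type_algebra\<^esub> = (1 :: 'a::field)" "\<zero>\<^bsub>ring_of_type_algebra\<^esub> = (0 :: 'a)"
  "(a :: 'a) \<otimes>\<^bsub>ring_of_type_algebra\<^esub> b = a * b" "a \<oplus>\<^bsub>ring_of_type_algebra\<^esub> b = a + b"
  by (simp_all add: ring_of_type_algebra_def)

lemma a_inv_ring_of_type_algebra: "\<ominus>\<^bsub>ring_of_type_algebra\<^esub> (a :: 'a::field) = - a"
proof -
  interpret field "ring_of_type_algebra :: 'a ring" by (rule field_from_type_algebra)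
  show ?thesis using minus_equality[of "- a" a] by simp
qed

lemma m_inv_ring_of_type_algebra:
  assumes "(a :: 'a::field) \<noteq> 0"
  shows "inv\<^bsub>ring_of_type_algebra\<^esub> a = inverse a"
proof -
  interpret field "ring_of_type_algebra :: 'a ring" by (rule field_from_type_algebra)
  show ?thesis using comm_inv_char[of a "inverse a"] assms by simp
qed

lemma field_generated_over_k_subset:
  assumes "\<And>c. poly_to_frac (const c) \<in> F" "\<And>f. f \<in> S \<Longrightarrow> poly_to_frac f \<in> F"
    and "\<And>u v. u \<in> F \<Longrightarrow> v \<in> F \<Longrightarrow> u + v \<in> F" "\<And>u v. u \<in> F \<Longrightarrow> v \<in> F \<Longrightarrow> u * v \<in> F"
    and "\<And>u. u \<in> F \<Longrightarrow> - u \<in> F" "\<And>u. u \<in> F \<Longrightarrow> inverse u \<in> F"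
  shows "field_generated_over_k S \<subseteq> F"
proof
  fix q assume "q \<in> field_generated_over_k S"
  then show "q \<in> F" unfolding field_generated_over_k_def
  proof induction
    case one
    then show ?case using assms(1)[of 1] by (simp add: poly_to_frac_def One_fract_def)
  qed (auto simp: a_inv_ring_of_type_algebra m_inv_ring_of_type_algebra intro: assms)
qed

lemma poly_to_frac_add: "poly_to_frac (f + g) = poly_to_frac f + poly_to_frac g"
  and poly_to_frac_mult: "poly_to_frac (f * g) = poly_to_frac f * poly_to_frac g"
  and poly_to_frac_eq_0_iff: "poly_to_frac f = 0 \<longleftrightarrow> f = 0"
  by (simp_all add: poly_to_frac_def Zero_fract_def eq_fract)

lemma field_generated_over_k_mult:
    "u \<in> field_generated_over_k S \<Longrightarrow> v \<in> field_generated_over_k S \<Longrightarrow> u * v \<in> field_generated_over_k S"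
  and field_generated_over_k_inverse:
    "u \<in> field_generated_over_k S \<Longrightarrow> u \<noteq> 0 \<Longrightarrow> inverse u \<in> field_generated_over_k S"
  and subalgebra_in_field_generated_over_k:
    "f \<in> subalgebra S \<Longrightarrow> poly_to_frac f \<in> field_generated_over_k S"
proof -
  show mult: "u * v \<in> field_generated_over_k S"
    if "u \<in> field_generated_over_k S" "v \<in> field_generated_over_k S" for u v
    using generate_field.eng_mult[OF that[unfolded field_generated_over_k_def]]
    by (simp add: field_generated_over_k_def)
  show "inverse u \<in> field_generated_over_k S" if "u \<in> field_generated_over_k S" "u \<noteq> 0"
    using generate_field.m_inv[of u ring_of_type_algebra] that
    by (simp add: field_generated_over_k_def m_inv_ring_of_type_algebra)
  show "poly_to_frac f \<in> field_generated_over_k S" if "f \<in> subalgebra S"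
    using that
  proof induction
    case (base f)
    then show ?case by (auto simp: field_generated_over_k_def intro: generate_field.incl)
  next
    case (add f g)
    then show ?case
      using generate_field.eng_add[of "poly_to_frac f" ring_of_type_algebra _ "poly_to_frac g"]
      by (simp add: field_generated_over_k_def poly_to_frac_add)
  qed (simp add: poly_to_frac_mult mult)
qed

section \<open>The cyclic group acting through its generator\<close>

locale cyclic_rep =
  fixes p :: nat
    and \<rho> :: "int \<Rightarrow> 'k::field ^ 'n::{finite, linorder} ^ 'n::{finite, linorder}"
  assumes prime: "Factorial_Ring.prime p" and hom: "\<rho> \<in> hom (integer_mod_group p) GL"
begin

abbreviation G :: "int monoid" where "G \<equiv> integer_mod_group p"

lemma p_gt_1: "1 < p" and p_gt_0: "0 < p"
  using prime prime_gt_1_nat by (auto simp: prime_gt_0_nat)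

lemma carrier_G: "carrier G = {0..<int p}"
  using p_gt_0 by (simp add: carrier_integer_mod_group)

lemma rep_mult: "\<rho> ((x + y) mod int p) = \<rho> (x mod int p) ** \<rho> (y mod int p)"
proof -
  have "\<rho> ((x mod int p) \<otimes>\<^bsub>G\<^esub> (y mod int p)) = \<rho> (x mod int p) \<otimes>\<^bsub>GL\<^esub> \<rho> (y mod int p)"
    using p_gt_0 by (intro hom_mult[OF hom]) (simp_all add: carrier_G)
  then show ?thesis by (simp add: GL_def mod_add_eq)
qed

lemma rep_0: "\<rho> 0 = mat 1"
proof -
  have "\<rho> 0 \<in> carrier GL" using hom p_gt_0 by (auto simp: hom_def carrier_G)
  then obtain A where "A ** \<rho> 0 = mat 1" by (auto simp: GL_def invertible_def)
  moreover have "\<rho> 0 ** \<rho> 0 = \<rho> 0" using rep_mult[of 0 0] by simp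
  ultimately show ?thesis by (metis matrix_mul_assoc matrix_mul_lid)
qed

text \<open>The generator 1 acts on functions through its inverse, hence the matrix of -1.\<close>

definition M :: "(('k, 'n) vec, 'n) vec" where "M = \<rho> ((- 1) mod int p)"

lemma rep_minus_Suc: "\<rho> ((- int (Suc g)) mod int p) = \<rho> ((- int g) mod int p) ** M"
proof -
  have "- int (Suc g) = - int g + - 1" by simp
  then show ?thesis unfolding M_def by (simp only: rep_mult)
qed

lemma linear_subst_M_pow: "(linear_subst M ^^ g) f = linear_subst (\<rho> ((- int g) mod int p)) f"
  by (induction g) (simp_all add: rep_0 rep_minus_Suc linear_subst_comp del: of_nat_Suc)

lemma linear_subst_M_period: "(linear_subst M ^^ p) f = f"
  by (simp add: linear_subst_M_pow rep_0)

lemma poly_act_eq: "g \<in> carrier G \<Longrightarrow> poly_act G \<rho> g = linear_subst M ^^ nat g"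
  by (rule ext) (simp add: poly_act_def linear_subst_M_pow carrier_G flip: linear_subst_def)

lemma one_in_G: "1 \<in> carrier G" and poly_act_1: "poly_act G \<rho> 1 = linear_subst M"
  using p_gt_1 by (simp_all add: carrier_G poly_act_eq)

lemma invariant_iff: "(\<forall>g\<in>carrier G. poly_act G \<rho> g f = f) \<longleftrightarrow> linear_subst M f = f"
proof
  assume "linear_subst M f = f"
  then have "(linear_subst M ^^ g) f = f" for g by (induction g) simp_all
  then show "\<forall>g\<in>carrier G. poly_act G \<rho> g f = f" by (simp add: poly_act_eq)
next
  assume "\<forall>g\<in>carrier G. poly_act G \<rho> g f = f"
  from bspec[OF this one_in_G] show "linear_subst M f = f" by (simp add: poly_act_1)
qed

lemma linear_subst_M_pow_mult:
    "(linear_subst M ^^ g) (a * b) = (linear_subst M ^^ g) a * (linear_subst M ^^ g) b"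
  and linear_subst_M_pow_add:
    "(linear_subst M ^^ g) (a + b) = (linear_subst M ^^ g) a + (linear_subst M ^^ g) b"
  by (simp_all add: linear_subst_M_pow linear_subst_mult linear_subst_add)

text \<open>A map of period p is injective; this keeps transformed denominators nonzero.\<close>

lemma linear_subst_M_pow_eq_0_iff: "(linear_subst M ^^ g) a = 0 \<longleftrightarrow> a = 0"
proof -
  have "linear_subst M a = 0 \<longleftrightarrow> a = 0" for a
  proof
    assume "linear_subst M a = 0"
    then have "(linear_subst M ^^ Suc (p - 1)) a = 0"
      unfolding funpow_Suc_right by (simp add: linear_subst_M_pow)
    then show "a = 0" using p_gt_0 linear_subst_M_period[of a] by simp
  qed simp
  then show ?thesis by (induction g) simp_all
qed

text \<open>Independence of the representative: a multiplicative map preserves the cross-multiplied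
  equation.\<close>

lemma frac_act_Fract:
  assumes g: "g \<in> carrier G" and b: "b \<noteq> 0"
  shows "frac_act G \<rho> g (Fraction_Field.Fract a b) =
    Fraction_Field.Fract ((linear_subst M ^^ nat g) a) ((linear_subst M ^^ nat g) b)"
  unfolding frac_act_def
proof (rule the_equality)
  fix r
  assume "\<exists>a' b'. b' \<noteq> 0 \<and> Fraction_Field.Fract a b = Fraction_Field.Fract a' b'
    \<and> r = Fraction_Field.Fract (poly_act G \<rho> g a') (poly_act G \<rho> g b')"
  then obtain a' b' where r: "b' \<noteq> 0" "a * b' = a' * b"
    "r = Fraction_Field.Fract ((linear_subst M ^^ nat g) a') ((linear_subst M ^^ nat g) b')"
    using b g by (auto simp: eq_fract poly_act_eq)
  show "r = Fraction_Field.Fract ((linear_subst M ^^ nat g) a) ((linear_subst M ^^ nat g) b)"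
    using r(1) b arg_cong[OF r(2), of "linear_subst M ^^ nat g"] unfolding r(3)
    by (simp add: eq_fract linear_subst_M_pow_eq_0_iff linear_subst_M_pow_mult)
qed (use b g in \<open>auto simp: poly_act_eq\<close>)

lemma frac_act_add: "g \<in> carrier G \<Longrightarrow> frac_act G \<rho> g (u + v) = frac_act G \<rho> g u + frac_act G \<rho> g v"
  and frac_act_mult: "g \<in> carrier G \<Longrightarrow> frac_act G \<rho> g (u * v) = frac_act G \<rho> g u * frac_act G \<rho> g v"
  by (cases u; cases v; simp add: frac_act_Fract linear_subst_M_pow_eq_0_iff
      linear_subst_M_pow_mult linear_subst_M_pow_add)+

lemma frac_act_poly:
  "g \<in> carrier G \<Longrightarrow> frac_act G \<rho> g (poly_to_frac f) = poly_to_frac ((linear_subst M ^^ nat g) f)"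
  by (simp add: poly_to_frac_def frac_act_Fract linear_subst_M_pow)

lemma invariant_field_closed:
  "u \<in> invariant_field G \<rho> \<Longrightarrow> v \<in> invariant_field G \<rho> \<Longrightarrow> u + v \<in> invariant_field G \<rho>"
  "u \<in> invariant_field G \<rho> \<Longrightarrow> v \<in> invariant_field G \<rho> \<Longrightarrow> u * v \<in> invariant_field G \<rho>"
  "u \<in> invariant_field G \<rho> \<Longrightarrow> - u \<in> invariant_field G \<rho>"
  "u \<in> invariant_field G \<rho> \<Longrightarrow> inverse u \<in> invariant_field G \<rho>"
proof -
  have 0: "frac_act G \<rho> g 0 = 0" and 1: "frac_act G \<rho> g 1 = 1" if "g \<in> carrier G" for g
    using that frac_act_poly[of g 0] frac_act_poly[of g 1]
    by (simp_all add: poly_to_frac_def One_fract_def Zero_fract_def linear_subst_M_pow)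
  show "- u \<in> invariant_field G \<rho>" if "u \<in> invariant_field G \<rho>"
  proof -
    have "frac_act G \<rho> g (- u) = - u" if "g \<in> carrier G" for g
      using frac_act_add[OF that, of u "- u"] 0[OF that] that \<open>u \<in> _\<close>
      by (simp add: invariant_field_def eq_neg_iff_add_eq_0 add.commute)
    then show ?thesis by (simp add: invariant_field_def)
  qed
  show "inverse u \<in> invariant_field G \<rho>" if "u \<in> invariant_field G \<rho>"
  proof (cases "u = 0")
    case False
    have "frac_act G \<rho> g (inverse u) = inverse u" if "g \<in> carrier G" for g
    proof -
      have "u * frac_act G \<rho> g (inverse u) = 1"
        using frac_act_mult[OF that, of u "inverse u"] 1[OF that] that \<open>u \<in> _\<close> False
        by (simp add: invariant_field_def)
      then show ?thesis by (metis inverse_unique)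
    qed
    then show ?thesis by (simp add: invariant_field_def)
  qed (use that in simp)
qed (simp_all add: invariant_field_def frac_act_add frac_act_mult)

text \<open>Expanding by the other translates of b turns the denominator into its norm
  \<open>d\<close>, which is invariant; the numerator \<open>a * c\<close> is then q times an
  invariant.\<close>

lemma invariant_field_fractions:
  assumes "q \<in> invariant_field G \<rho>"
  shows "\<exists>a b. b \<noteq> 0 \<and> linear_subst M a = a \<and> linear_subst M b = b
    \<and> q = poly_to_frac a * inverse (poly_to_frac b)"
proof -
  obtain a b where q: "q = Fraction_Field.Fract a b" "b \<noteq> 0" by (cases q)
  define d where "d = (\<Prod>g<p. (linear_subst M ^^ g) b)"
  define c where "c = (\<Prod>g<p - 1. (linear_subst M ^^ Suc g) b)"
  have d: "d = b * c"
    using p_gt_0 prod.lessThan_Suc_shift[of "\<lambda>g. (linear_subst M ^^ g) b" "p - 1"]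
    by (simp add: d_def c_def)
  have nz: "d \<noteq> 0" by (simp add: d_def linear_subst_M_pow_eq_0_iff q)
  \<comment> \<open>Both sides are the product of p + 1 consecutive translates of b, the first and
    the last being b itself by periodicity.\<close>
  have "b * d = b * (\<Prod>g<p. (linear_subst M ^^ Suc g) b)"
    using prod.lessThan_Suc_shift[of "\<lambda>g. (linear_subst M ^^ g) b" p]
    by (simp add: d_def linear_subst_M_period mult.commute)
  then have "d = (\<Prod>g<p. (linear_subst M ^^ Suc g) b)"
    using mult_left_cancel[OF q(2)] by blast
  moreover have "linear_subst M d = (\<Prod>g<p. (linear_subst M ^^ Suc g) b)"
    by (simp add: d_def linear_subst_prod)
  ultimately have inv_d: "linear_subst M d = d" by (simp only:)
  have q': "q = Fraction_Field.Fract (a * c) d"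
    using q nz d by (simp add: eq_fract)
  have "frac_act G \<rho> 1 q = q" using assms one_in_G by (simp add: invariant_field_def)
  then have "linear_subst M (a * c) = a * c"
    using nz inv_d unfolding q' by (simp add: frac_act_Fract[OF one_in_G] eq_fract)
  with nz inv_d show ?thesis
    unfolding q' by (intro exI[of _ "a * c"] exI[of _ d]) (simp add: poly_to_frac_def)
qed

text \<open>Invariant polynomials are enough to consider, since every invariant fraction is a
  quotient of two of them.\<close>

lemma beta_field_le:
  assumes "\<And>f. linear_subst M f = f \<Longrightarrow>
    \<exists>D \<in> subalgebra {f. degree_le d f \<and> linear_subst M f = f}.
      D \<noteq> 0 \<and> f * D \<in> subalgebra {f. degree_le d f \<and> linear_subst M f = f}"
  shows "beta_field G \<rho> \<le> d"
  unfolding beta_field_def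
proof (rule Least_le, rule equalityI)
  let ?I = "{f. degree_le d f \<and> linear_subst M f = f}"
  have I: "invariant_polys_le G \<rho> d = ?I"
    by (simp add: invariant_polys_le_def invariant_iff)
  have "poly_to_frac f \<in> invariant_field G \<rho>" if "linear_subst M f = f" for f
  proof -
    have "(linear_subst M ^^ g) f = f" for g using that by (induction g) simp_all
    then show ?thesis by (simp add: invariant_field_def frac_act_poly)
  qed
  then show "field_generated_over_k (invariant_polys_le G \<rho> d) \<subseteq> invariant_field G \<rho>"
    unfolding I by (intro field_generated_over_k_subset) (auto intro: invariant_field_closed)
  have poly: "poly_to_frac f \<in> field_generated_over_k ?I" if f: "linear_subst M f = f" for f
  proof -
    obtain D where D: "D \<in> subalgebra ?I" "D \<noteq> 0" "f * D \<in> subalgebra ?I"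
      using assms[OF f] by blast
    have "poly_to_frac f = poly_to_frac (f * D) * inverse (poly_to_frac D)"
      using D by (simp add: poly_to_frac_mult poly_to_frac_eq_0_iff)
    also have "\<dots> \<in> field_generated_over_k ?I"
      using D by (intro field_generated_over_k_mult field_generated_over_k_inverse
          subalgebra_in_field_generated_over_k) (auto simp: poly_to_frac_eq_0_iff)
    finally show ?thesis .
  qed
  show "invariant_field G \<rho> \<subseteq> field_generated_over_k (invariant_polys_le G \<rho> d)"
    unfolding I
  proof
    fix q assume "q \<in> invariant_field G \<rho>"
    then obtain a b where "b \<noteq> 0" "linear_subst M a = a" "linear_subst M b = b"
      "q = poly_to_frac a * inverse (poly_to_frac b)"
      using invariant_field_fractions by blast
    then show "q \<in> field_generated_over_k ?I"
      using poly by (auto intro!: field_generated_over_k_mult field_generated_over_k_inverse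
          simp: poly_to_frac_eq_0_iff)
  qed
qed

end

section \<open>Characters of the cyclic group\<close>

lemma character_of_integer_mod_group:
  fixes \<psi> :: "int \<Rightarrow> 'c::field"
  assumes p: "p > 1" and \<psi>: "\<psi> \<in> characters (integer_mod_group p)"
  shows "\<psi> 1 ^ p = 1"
    and "g \<in> carrier (integer_mod_group p) \<Longrightarrow> \<psi> g = \<psi> 1 ^ nat g"
    and "g \<notin> carrier (integer_mod_group p) \<Longrightarrow> \<psi> g = undefined"
proof -
  have carrier: "carrier (integer_mod_group p) = {0..<int p}"
    using p by (simp add: carrier_integer_mod_group)
  \<comment> \<open>Extensionality fixes the values outside the carrier, so that
    \<open>\<psi> 1\<close> determines the character as a function.\<close>
  show "\<psi> g = undefined" if "g \<notin> carrier (integer_mod_group p)"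
    using \<psi> that by (auto simp: characters_def extensional_def)
  have mult: "\<psi> ((x + y) mod int p) = \<psi> x * \<psi> y" if "x \<in> {0..<int p}" "y \<in> {0..<int p}" for x y
    using \<psi> that carrier by (auto simp: characters_def hom_def units_of_def)
  have "\<psi> 0 \<in> Units (ring_of_type_algebra :: 'c ring)"
    using \<psi> p carrier by (auto simp: characters_def hom_def units_of_def)
  then have "\<psi> 0 \<noteq> 0" by (auto simp: Units_def)
  then have one: "\<psi> 0 = 1" using mult[of 0 0] p by simp
  have pow: "\<psi> (int n mod int p) = \<psi> 1 ^ n" for n
  proof (induction n)
    case (Suc n)
    have "\<psi> ((int n mod int p + 1) mod int p) = \<psi> (int n mod int p) * \<psi> 1"
      using p by (intro mult) auto
    then show ?case using Suc by (simp add: mod_simps add.commute)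
  qed (simp add: one)
  show "\<psi> 1 ^ p = 1" using pow[of p] one by simp
  show "\<psi> g = \<psi> 1 ^ nat g" if "g \<in> carrier (integer_mod_group p)"
    using pow[of "nat g"] that carrier by simp
qed

text \<open>The first p powers of \<zeta> are distinct, so they exhaust the p roots.\<close>

lemma roots_of_unity_are_powers:
  fixes \<zeta> :: "'c::field"
  assumes p: "Factorial_Ring.prime p" and \<zeta>: "\<zeta> ^ p = 1" "\<zeta> \<noteq> 1"
    and card: "card {z :: 'c. z ^ p = 1} = p" and z: "z ^ p = 1"
  shows "\<exists>j<p. z = \<zeta> ^ j"
proof -
  have nz: "\<zeta> \<noteq> 0" using \<zeta> p by (auto simp: power_0_left prime_gt_0_nat split: if_splits)
  have root: "(\<zeta> ^ j) ^ p = 1" for j by (metis \<zeta>(1) power_mult mult.commute power_one)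
  have "inj_on (\<lambda>j. \<zeta> ^ j) {..<p}"
  proof (rule linorder_inj_onI)
    fix i j assume ij: "i < j" "i \<in> {..<p}" "j \<in> {..<p}"
    have "\<not> p dvd j - i" using ij by (auto dest: dvd_imp_le)
    then have "\<zeta> ^ (j - i) \<noteq> 1" using root_of_unity_power_eq_1_iff[OF p \<zeta>] by simp
    moreover have "\<zeta> ^ j = \<zeta> ^ i * \<zeta> ^ (j - i)" using ij by (simp flip: power_add)
    ultimately show "\<zeta> ^ i \<noteq> \<zeta> ^ j" using nz by simp
  qed auto
  then have "card ((\<lambda>j. \<zeta> ^ j) ` {..<p}) = card {z :: 'c. z ^ p = 1}"
    by (simp add: card_image card)
  moreover have "(\<lambda>j. \<zeta> ^ j) ` {..<p} \<subseteq> {z. z ^ p = 1}"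
    using root by auto
  moreover have "finite {z :: 'c. z ^ p = 1}"
    using card p by (metis card.infinite not_prime_0)
  ultimately have "(\<lambda>j. \<zeta> ^ j) ` {..<p} = {z. z ^ p = 1}" by (intro card_subset_eq) auto
  then show ?thesis using z by blast
qed

section \<open>From three characters to two weights\<close>

theorem theorem3p11:
  fixes p :: nat
    and \<rho> :: "int \<Rightarrow> 'k::field ^ 'n::{finite, linorder} ^ 'n::{finite, linorder}"
    and \<iota> :: "'k \<Rightarrow> 'c::field"
  assumes "Factorial_Ring.prime p"
    and "CHAR('k) \<noteq> p"
    and "\<rho> \<in> hom (integer_mod_group p) GL"
    and "field_embedding \<iota>"
    and "card {z :: 'c. z ^ p = 1} = p"
    and "card {\<psi> \<in> characters (integer_mod_group p).
           nontrivial_char (integer_mod_group p) \<psi> \<and> occurs_in (integer_mod_group p) \<iota> \<rho> \<psi>} \<ge> 3"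
  shows "real (beta_field (integer_mod_group p) \<rho>) \<le> (real p + 3) / 2"
proof -
  interpret cyclic_rep p \<rho> by unfold_locales fact+
  interpret field_ext \<iota>
    using assms(4) by unfold_locales (auto simp: field_embedding_def ring_hom_def)
  let ?M = "map_matrix \<iota> M"
  have "\<not> {z :: 'c. z ^ p = 1} \<subseteq> {1}"
  proof
    assume "{z :: 'c. z ^ p = 1} \<subseteq> {1}"
    then have "card {z :: 'c. z ^ p = 1} \<le> card {1 :: 'c}" by (intro card_mono) auto
    then show False using assms(5) p_gt_1 by simp
  qed
  then obtain \<zeta> :: 'c where \<zeta>: "\<zeta> ^ p = 1" "\<zeta> \<noteq> 1" by auto
  have "\<not> CHAR('k) dvd p"
    using assms(1,2) CHAR_not_1'[where ?'a = 'k] by (auto simp: prime_nat_iff)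
  then have "(of_nat p :: 'k) \<noteq> 0" by (simp add: of_nat_eq_0_iff_char_dvd)
  then have p_nz: "(of_nat p :: 'c) \<noteq> 0" by (metis emb_of_nat emb_eq_0_iff)
  have pow: "(linear_subst ?M ^^ g) f = linear_subst (map_matrix \<iota> (\<rho> ((- int g) mod int p))) f" for g f
    by (induction g) (simp_all add: rep_0 map_matrix_mat_1 rep_minus_Suc map_matrix_mult linear_subst_comp del: of_nat_Suc)
  interpret diagonalizable p ?M \<zeta>
    using \<zeta> p_nz prime by unfold_locales (simp_all add: pow rep_0 map_matrix_mat_1)

  let ?C = "{\<psi> \<in> characters G. nontrivial_char G \<psi> \<and> occurs_in G \<iota> \<rho> \<psi>}"
  let ?J = "{j. j < p \<and> j \<noteq> 0 \<and> (\<exists>i. eigenform (i, j) \<noteq> 0)}"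
  \<comment> \<open>\<open>M\<close> inverts \<open>\<rho> 1\<close>, so the weight found is that of
    the inverse of \<open>\<psi> 1\<close>; as inversion is injective, distinct characters still
    give distinct weights.\<close>
  have weight: "\<exists>j\<in>?J. inverse (\<psi> 1) = \<zeta> ^ j" if \<psi>: "\<psi> \<in> ?C" for \<psi>
  proof -
    note char = character_of_integer_mod_group[OF p_gt_1, of \<psi>]
    have root: "\<psi> 1 ^ p = 1" using \<psi> char(1) by simp
    then have nz: "\<psi> 1 \<noteq> 0" using p_gt_0 by (auto simp: power_0_left)
    obtain j where j: "j < p" "inverse (\<psi> 1) = \<zeta> ^ j"
      using roots_of_unity_are_powers[OF prime \<zeta> assms(5), of "inverse (\<psi> 1)"] root
      by (auto simp: power_inverse)
    have "\<psi> 1 \<noteq> 1" using \<psi> char(2) by (auto simp: nontrivial_char_def)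
    then have "j \<noteq> 0" using j by (intro notI) simp
    obtain v where v: "v \<noteq> 0" "map_matrix \<iota> (\<rho> 1) *v v = \<psi> 1 *s v"
      using \<psi> one_in_G by (auto simp: occurs_in_def)
    have "M ** \<rho> 1 = mat 1" using rep_mult[of "- 1" 1] p_gt_1 by (simp add: M_def rep_0)
    then have "?M ** map_matrix \<iota> (\<rho> 1) = mat 1" by (metis map_matrix_mult map_matrix_mat_1)
    then have "v = ?M *v (map_matrix \<iota> (\<rho> 1) *v v)"
      by (simp add: matrix_vector_mul_assoc)
    also have "\<dots> = \<psi> 1 *s (?M *v v)" by (simp add: v vector_scalar_commute)
    finally have "inverse (\<psi> 1) *s v = inverse (\<psi> 1) *s (\<psi> 1 *s (?M *v v))" by simp
    then have "?M *v v = inverse (\<psi> 1) *s v" using nz by (simp add: vector_smult_assoc)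
    then have "?M *v v = \<zeta> ^ j *s v" by (simp only: j(2))
    from eigenform_nonzero[OF v(1) this] show ?thesis using j \<open>j \<noteq> 0\<close> by blast
  qed
  then have "\<forall>\<psi>\<in>?C. \<exists>j. j \<in> ?J \<and> inverse (\<psi> 1) = \<zeta> ^ j" by blast
  from bchoice[OF this] obtain J
    where J: "\<forall>\<psi>\<in>?C. J \<psi> \<in> ?J \<and> inverse (\<psi> 1) = \<zeta> ^ J \<psi>" ..
  have "inj_on J ?C"
  proof (rule inj_onI)
    fix \<psi> \<psi>' assume \<psi>: "\<psi> \<in> ?C" "\<psi>' \<in> ?C" "J \<psi> = J \<psi>'"
    have "inverse (\<psi> 1) = inverse (\<psi>' 1)"
      using bspec[OF J \<psi>(1)] bspec[OF J \<psi>(2)] \<psi>(3) by simp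
    then have eq: "\<psi> 1 = \<psi>' 1" by simp
    have "\<psi> \<in> characters G" "\<psi>' \<in> characters G" using \<psi> by auto
    note char = this[THEN character_of_integer_mod_group(2)[OF p_gt_1]]
      this[THEN character_of_integer_mod_group(3)[OF p_gt_1]]
    show "\<psi> = \<psi>'"
    proof
      fix g
      show "\<psi> g = \<psi>' g" using char[of g] eq by (cases "g \<in> carrier G") simp_all
    qed
  qed
  moreover have "J ` ?C \<subseteq> ?J"
  proof (rule image_subsetI)
    fix \<psi> assume "\<psi> \<in> ?C"
    from bspec[OF J this] show "J \<psi> \<in> ?J" by (rule conjunct1)
  qed
  moreover have "finite ?J" by simp
  ultimately have "card ?C \<le> card ?J" by (rule card_inj_on_le)
  with assms(6) have J3: "3 \<le> card ?J" by (rule le_trans)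
  have "?J \<noteq> {}"
  proof
    assume "?J = {}"
    with J3 show False by (simp only: card.empty)
  qed
  then obtain j where j: "j \<in> ?J" unfolding ex_in_conv[symmetric] ..
  have "card {j, p - j} \<le> 2" by (simp add: card_insert_if)
  \<comment> \<open>At least three weights remain nonempty after removing j and p - j; what is left
    is neither equal nor opposite to j modulo p.\<close>
  have "\<not> ?J \<subseteq> {j, p - j}"
  proof
    assume "?J \<subseteq> {j, p - j}"
    then have "card ?J \<le> card {j, p - j}" by (intro card_mono) simp_all
    with J3 \<open>card {j, p - j} \<le> 2\<close> show False by linarith
  qed
  then obtain j' where j': "j' \<in> ?J" "j' \<noteq> j" "j' \<noteq> p - j" by blast
  obtain i i' where ii: "eigenform (i, j) \<noteq> 0" "eigenform (i', j') \<noteq> 0" using j j' by blast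
  \<comment> \<open>Three weights between 1 and p - 1 force p > 2, hence p odd.\<close>
  have "card ?J \<le> card {1..<p}" by (intro card_mono) auto
  then have "p > 2" using J3 by simp
  then have odd: "odd p" using prime prime_odd_nat by blast
  have ndvd: "\<not> p dvd j" "\<not> p dvd j'" using j j' by (auto dest: dvd_imp_le)
  have ncong: "\<not> [j = j'] (mod p)" using cong_less_imp_eq_nat[of j p j'] j j' by auto
  have nsum: "\<not> p dvd j + j'"
  proof
    assume "p dvd j + j'"
    then obtain k where k: "j + j' = p * k" by auto
    \<comment> \<open>The sum lies strictly between 0 and 2 p, so it could only be p, which the
      choice of j' excludes.\<close>
    have "p * k < p * 2" "0 < p * k" using j j' unfolding k[symmetric] by auto
    then have "k = 1" by (cases k) auto
    then show False using k j' by simp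
  qed
  have "beta_field G \<rho> \<le> (p + 3) div 2"
  proof (rule beta_field_le)
    fix f assume "linear_subst M f = f"
    then have "\<Phi> (lift f) = lift f" by (metis lift_linear_subst)
    from invariant_in_fractions[OF odd this ii] ndvd ncong nsum
    show "\<exists>D \<in> subalgebra {f. degree_le ((p + 3) div 2) f \<and> linear_subst M f = f}.
        D \<noteq> 0 \<and> f * D \<in> subalgebra {f. degree_le ((p + 3) div 2) f \<and> linear_subst M f = f}"
      by (auto intro: descend_fraction)
  qed
  then have "2 * beta_field G \<rho> \<le> p + 3" by linarith
  then have "real (2 * beta_field G \<rho>) \<le> real (p + 3)" by (simp only: of_nat_le_iff)
  then show ?thesis by simp
qed

end
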